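(* Let $P\subset\mathbb{H}^4$ be the hyperbolic regular right-angled $120$-cell, let $\mathcal{C}$ be the set of $24$ pairwise disjoint walls of $P$ whose normal vectors are the $8$ vectors obtained by permuting the last four coordinates of $(\sqrt{2\tau},\pm2,0,0,0)$ and the $16$ vectors $(\sqrt{2\tau},\pm1,\pm1,\pm1,\pm1)$, and let $\Gamma<G_4=\mathrm{Isom}(\mathbb{H}^4)<\mathrm{O}(1,4)$ be the discrete infinite covolume group generated by the reflections in the $96$ walls of $P$ not in $\mathcal{C}$. Then the inclusion map $\Gamma\to G_4$ is infinitesimally rigid in the representation variety $\mathrm{Hom}(\Gamma,G_4)$.
   Context: Minkowski form on $\mathbb{R}^5$: $(x,y)=-x_0y_0+\sum_{i=1}^4x_iy_i$; $\mathbb{H}^4=\{x:(x,x)=-1,x_0>0\}$; $\mathrm{O}(1,4)=\{A:A^TMA=M\}$, $M=\mathrm{diag}(-1,1,1,1,1)$; $G_4$ is the open subgroup of $\mathrm{O}(1,4)$ preserving $\mathbb{H}^4$. With $\tau=(1+\sqrt5)/2$, $P$ is the compact polytope bounded by the $120$ hyperplanes $\vec n^\perp\cap\mathbb{H}^4$ for $\vec n$ among the $24$ vectors listed above together with the $96$ vectors obtained by even permutations of the last four coordinates of $(\sqrt{2\tau},\pm\tau,\pm1,\pm\tau^{-1},0)$; its walls are dodecahedra, intersecting walls meet at right angles. The reflection in a wall with normal $\vec n$ is the element of $G_4$ fixing $\vec n^\perp$ and sending $\vec n\mapsto-\vec n$. $\Gamma$ has presentation $\langle r_1,\dots,r_{96}\mid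 r_i^2=1,\ (r_ir_j)^2=1 \text{ whenever the corresponding walls intersect}\rangle$. Given this presentation, $\mathrm{Hom}(\Gamma,\mathrm{O}(1,4))$ is the zero set in $V=\mathbb{R}^{25\cdot 96}$ (tuples of matrices $\rho(r_j)$) of the polynomial equations $P_\alpha$ expressing $\rho(r_j)^TM\rho(r_j)=M$ and each relation; $\mathrm{Hom}(\Gamma,G_4)$ is the union of components where each $\rho(r_j)$ has positive upper-left entry. $G_4$ acts by conjugation. An infinitesimal deformation of $\rho$ is a tangent vector $p'(0)\in T_\rho V$ of a smooth path $p:(-\varepsilon,\varepsilon)\to V$ with $p(0)=\rho$ and $\frac{d}{dt}|_0P_\alpha(p(t))=0$ for all $\alpha$; an infinitesimal conjugation is a tangent vector at $\rho$ to a smooth path in the orbit $G_4\cdot\rho$; $\rho$ is infinitesimally rigid if every infinitesimal deformation is an infinitesimal conjugation. *)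

theory Defs
  imports "HOL-Analysis.Analysis" "HOL-Combinatorics.Permutations"
begin

definition mink :: "real^5 \<Rightarrow> real^5 \<Rightarrow> real" where
  "mink x y = - (x$0 * y$0) + x$1 * y$1 + x$2 * y$2 + x$3 * y$3 + x$4 * y$4"

definition Mmat :: "real^5^5" where
  "Mmat = (\<chi> i j. if i = j then (if i = 0 then -1 else 1) else 0)"

definition H4 :: "(real^5) set" where
  "H4 = {x. mink x x = -1 \<and> x$0 > 0}"

definition O14 :: "(real^5^5) set" where
  "O14 = {A. transpose A ** Mmat ** A = Mmat}"

definition G4 :: "(real^5^5) set" where
  "G4 = {A \<in> O14. \<forall>x\<in>H4. A *v x \<in> H4}"

definition tau :: real where "tau = (1 + sqrt 5) / 2"

definition vec5 :: "(nat \<Rightarrow> real) \<Rightarrow> real^5" where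
  "vec5 f = (\<chi> i::5. if i = 0 then f 0 else if i = 1 then f 1 else if i = 2 then f 2
                      else if i = 3 then f 3 else f 4)"

definition normalsC :: "(real^5) set" where
  "normalsC =
     {vec5 (\<lambda>k. if k = 0 then sqrt (2*tau) else if k = m then s * 2 else 0) | m s.
        m \<in> {1..4} \<and> s \<in> {-1, 1}}
   \<union> {vec5 (\<lambda>k. if k = 0 then sqrt (2*tau) else s k) | s.
        \<forall>k\<in>{1..4}. s k \<in> {-1, 1}}"

definition normals96 :: "(real^5) set" where
  "normals96 =
     {vec5 (\<lambda>k. if k = 0 then sqrt (2*tau)
                else (\<lambda>j. if j = 1 then s1 * tau else if j = 2 then s2
                          else if j = 3 then s3 / tau else 0) (\<sigma> k)) | \<sigma> s1 s2 s3.
        \<sigma> permutes {1..4} \<and> evenperm \<sigma> \<and> s1 \<in> {-1, 1} \<and> s2 \<in> {-1, 1} \<and> s3 \<in> {-1, 1}}"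

definition normals120 :: "(real^5) set" where
  "normals120 = normalsC \<union> normals96"

text \<open>The polytope P: the side of each hyperplane containing (1,0,0,0,0).\<close>
definition P120 :: "(real^5) set" where
  "P120 = {x \<in> H4. \<forall>n\<in>normals120. mink x n \<le> 0}"

definition wall :: "real^5 \<Rightarrow> (real^5) set" where
  "wall n = {x \<in> P120. mink x n = 0}"

definition walls_intersect :: "real^5 \<Rightarrow> real^5 \<Rightarrow> bool" where
  "walls_intersect n m \<longleftrightarrow> wall n \<inter> wall m \<noteq> {}"

definition refl_mat :: "real^5 \<Rightarrow> real^5^5" where
  "refl_mat n = (THE A. A \<in> G4 \<and> (\<forall>x. mink x n = 0 \<longrightarrow> A *v x = x) \<and> A *v n = - n)"

text \<open>Tuples in V are indexed by the 96 generators, i.e. by their normals.\<close>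
type_synonym tuple = "real^5 \<Rightarrow> real^5^5"

definition smooth_on :: "real set \<Rightarrow> (real \<Rightarrow> 'a::real_normed_vector) \<Rightarrow> bool" where
  "smooth_on S f \<longleftrightarrow> (\<exists>D. (\<forall>t\<in>S. D 0 t = f t) \<and>
      (\<forall>k. \<forall>t\<in>S. (D k has_vector_derivative D (Suc k) t) (at t)))"

definition smooth_path :: "real \<Rightarrow> (real \<Rightarrow> tuple) \<Rightarrow> bool" where
  "smooth_path e p \<longleftrightarrow> (\<forall>n\<in>normals96. smooth_on {-e<..<e} (\<lambda>t. p t n))"

text \<open>The polynomial equations P_alpha, grouped into matrix-valued equations.\<close>
definition inf_deformation :: "tuple \<Rightarrow> tuple \<Rightarrow> bool" where
  "inf_deformation \<rho> v \<longleftrightarrow> (\<exists>e>0. \<exists>p. smooth_path e p \<and>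
      (\<forall>n\<in>normals96. p 0 n = \<rho> n \<and> ((\<lambda>t. p t n) has_vector_derivative v n) (at 0)) \<and>
      (\<forall>n\<in>normals96. ((\<lambda>t. transpose (p t n) ** Mmat ** p t n - Mmat)
                           has_vector_derivative 0) (at 0)) \<and>
      (\<forall>n\<in>normals96. ((\<lambda>t. p t n ** p t n - mat 1) has_vector_derivative 0) (at 0)) \<and>
      (\<forall>n\<in>normals96. \<forall>m\<in>normals96. n \<noteq> m \<and> walls_intersect n m \<longrightarrow>
          ((\<lambda>t. (p t n ** p t m) ** (p t n ** p t m) - mat 1) has_vector_derivative 0) (at 0)))"

definition inf_conjugation :: "tuple \<Rightarrow> tuple \<Rightarrow> bool" where
  "inf_conjugation \<rho> v \<longleftrightarrow> (\<exists>e>0. \<exists>p. smooth_path e p \<and>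
      (\<forall>n\<in>normals96. p 0 n = \<rho> n \<and> ((\<lambda>t. p t n) has_vector_derivative v n) (at 0)) \<and>
      (\<forall>t\<in>{-e<..<e}. \<exists>g\<in>G4. \<forall>n\<in>normals96. p t n = g ** \<rho> n ** matrix_inv g))"

definition inf_rigid :: "tuple \<Rightarrow> bool" where
  "inf_rigid \<rho> \<longleftrightarrow> (\<forall>v. inf_deformation \<rho> v \<longrightarrow> inf_conjugation \<rho> v)"

end

theory Submission
  imports Defs
begin

text \<open>
  Write the normals as \<open>n = (s, x)\<close> with \<open>s\<^sup>2 = 2\<tau>\<close>. Differentiating the relations \<open>r_n\<^sup>2 = 1\<close> and
  \<open>r_n \<in> O(1,4)\<close>, an infinitesimal deformation moves each normal by some \<open>w_n\<close> orthogonal to \<open>n\<close>, and the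
  commutation relations say \<open>(w_n, m) + (n, w_m) = 0\<close> for intersecting walls. In terms of the spatial
  parts \<open>u_x\<close> of \<open>w_n\<close> this reads \<open>(u_x - u_y) \<bullet> (x - y) = 0\<close> for \<open>x \<bullet> y = 2\<tau>\<close>: an infinitesimal motion
  of the bar framework in \<open>R\<^sup>4\<close> formed by the edges of the snub 24-cell (the 600-cell with 24
  vertices removed). Explicit self-stresses show that the squared distance is also preserved to
  first order for all pairs with \<open>x \<bullet> y = 2\<close>, first for the diagonals of the 24 icosahedral cells, then for the
  remaining pairs. After subtracting an infinitesimal isometry that agrees with the motion on five vertices, a
  chain of vertices, each joined to four earlier ones in independent directions, shows that the
  motion vanishes. The infinitesimal isometry is an element \<open>X\<close> of the Lie algebra
  of \<open>O(1,4)\<close>, and conjugation by \<open>exp (t X)\<close> realises the deformation.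
\<close>

section \<open>Infinitesimal motions of bar frameworks\<close>

definition preserves_length :: "('v \<Rightarrow> 'a::real_inner) \<Rightarrow> ('v \<Rightarrow> 'a) \<Rightarrow> 'v \<Rightarrow> 'v \<Rightarrow> bool" where
  "preserves_length p u x y \<longleftrightarrow> (u x - u y) \<bullet> (p x - p y) = 0"

lemma self_stress_zero_power:
  fixes p u :: "'v \<Rightarrow> 'a::real_inner"
  assumes symmetric: "\<And>x y. x \<in> V \<Longrightarrow> y \<in> V \<Longrightarrow> w y x = w x y"
    and balanced: "\<And>x. x \<in> V \<Longrightarrow> (\<Sum>y\<in>V. w x y *\<^sub>R (p y - p x)) = 0"
  shows "(\<Sum>x\<in>V. \<Sum>y\<in>V. w x y * ((u x - u y) \<bullet> (p x - p y))) = 0"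
proof -
  define S where "S = (\<Sum>x\<in>V. \<Sum>y\<in>V. w x y * (u x \<bullet> (p y - p x)))"
  have "S = (\<Sum>x\<in>V. u x \<bullet> (\<Sum>y\<in>V. w x y *\<^sub>R (p y - p x)))"
    by (simp add: S_def inner_sum_right)
  then have "S = 0" by (simp add: balanced)
  have "(\<Sum>x\<in>V. \<Sum>y\<in>V. w x y * (u y \<bullet> (p x - p y))) = S"
    unfolding S_def by (subst sum.swap) (intro sum.cong refl, simp add: symmetric)
  moreover have "w x y * ((u x - u y) \<bullet> (p x - p y)) =
      - (w x y * (u x \<bullet> (p y - p x))) - w x y * (u y \<bullet> (p x - p y))" for x y
    by (simp add: algebra_simps)
  ultimately show ?thesis
    using \<open>S = 0\<close> by (simp add: sum_subtractf sum_negf S_def)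
qed

lemma preserves_length_if_self_stress:
  fixes p u :: "'v \<Rightarrow> 'a::real_inner"
  assumes "finite V" "a \<in> V" "b \<in> V" "w a b \<noteq> 0"
    and symmetric: "\<And>x y. x \<in> V \<Longrightarrow> y \<in> V \<Longrightarrow> w y x = w x y"
    and balanced: "\<And>x. x \<in> V \<Longrightarrow> (\<Sum>y\<in>V. w x y *\<^sub>R (p y - p x)) = 0"
    and supported: "\<And>x y. x \<in> V \<Longrightarrow> y \<in> V \<Longrightarrow>
      w x y = 0 \<or> preserves_length p u x y \<or> {x, y} = {a, b}"
  shows "preserves_length p u a b"
proof (cases "a = b")
  case False
  define e where "e z = (case z of (x, y) \<Rightarrow> w x y * ((u x - u y) \<bullet> (p x - p y)))" for z
  have "0 = sum e (V \<times> V)"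
    using self_stress_zero_power[OF symmetric balanced, where u = u]
    by (simp add: e_def sum.cartesian_product)
  also have "\<dots> = sum e {(a, b), (b, a)}"
  proof (rule sum.mono_neutral_right)
    show "\<forall>z\<in>V \<times> V - {(a, b), (b, a)}. e z = 0"
      using supported by (fastforce simp: e_def preserves_length_def doubleton_eq_iff)
  qed (use assms in auto)
  also have "\<dots> = 2 * w a b * ((u a - u b) \<bullet> (p a - p b))"
    using False assms(2,3) symmetric[of a b] by (simp add: e_def algebra_simps)
  finally show ?thesis using \<open>w a b \<noteq> 0\<close> by (simp add: preserves_length_def)
qed (simp add: preserves_length_def)

definition skew :: "('a::real_inner \<Rightarrow> 'a) \<Rightarrow> bool" where
  "skew W \<longleftrightarrow> linear W \<and> (\<forall>x y. x \<bullet> W y = - (W x \<bullet> y))"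

lemma skew_inner_self: "skew W \<Longrightarrow> W x \<bullet> x = 0"
  by (metis inner_commute neg_equal_zero skew_def)

definition infinitesimal_isometry :: "('a::real_inner \<Rightarrow> 'a) \<Rightarrow> bool" where
  "infinitesimal_isometry f \<longleftrightarrow> (\<exists>b W. skew W \<and> f = (\<lambda>x. b + W x))"

lemma infinitesimal_isometry_orthogonal:
  assumes "infinitesimal_isometry f"
  shows "(f x - f y) \<bullet> (x - y) = 0"
proof -
  obtain b W where W: "skew W" "f = (\<lambda>x. b + W x)"
    using assms by (auto simp: infinitesimal_isometry_def)
  have "linear W" using W(1) by (simp add: skew_def)
  then have "f x - f y = W (x - y)" by (simp add: W(2) linear_diff)
  then show ?thesis by (simp only: skew_inner_self[OF W(1)])
qed

lemma dual_basis_exists: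
  fixes d :: "'i \<Rightarrow> 'a::euclidean_space"
  assumes "independent (d ` I)" and inj: "inj_on d I"
  obtains f where "\<And>i j. i \<in> I \<Longrightarrow> j \<in> I \<Longrightarrow> f i \<bullet> d j = (if i = j then 1 else 0)"
proof -
  have "\<exists>f. \<forall>j\<in>I. f \<bullet> d j = (if i = j then 1 else 0)" if "i \<in> I" for i
  proof -
    obtain g :: "'a \<Rightarrow> real" where g: "linear g" "\<And>x. x \<in> d ` I \<Longrightarrow> g x = (if x = d i then 1 else 0)"
      using linear_independent_extend[OF assms(1), of "\<lambda>x. if x = d i then 1 else 0"] by blast
    have "adjoint g 1 \<bullet> d j = (if i = j then 1 else 0)" if "j \<in> I" for j
    proof -
      have "adjoint g 1 \<bullet> d j = g (d j)"
        using adjoint_works[OF g(1), of "d j" 1] by (simp add: inner_commute)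
      then show ?thesis using g(2) inj \<open>i \<in> I\<close> that by (auto simp: inj_on_eq_iff)
    qed
    then show ?thesis by blast
  qed
  then show ?thesis using that by metis
qed

lemma skew_extension_if_dual_basis:
  fixes d f w :: "'i \<Rightarrow> 'a::real_inner"
  assumes "finite I"
    and dual: "\<And>i j. i \<in> I \<Longrightarrow> j \<in> I \<Longrightarrow> f i \<bullet> d j = (if i = j then 1 else 0)"
    and skew: "\<And>i j. i \<in> I \<Longrightarrow> j \<in> I \<Longrightarrow> w i \<bullet> d j + d i \<bullet> w j = 0"
  obtains W where "skew W" "\<And>i. i \<in> I \<Longrightarrow> W (d i) = w i"
proof -
  define A F A' where "A x = (\<Sum>i\<in>I. (f i \<bullet> x) *\<^sub>R w i)" and "F x = (\<Sum>i\<in>I. (f i \<bullet> x) *\<^sub>R d i)"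
    and "A' x = (\<Sum>i\<in>I. (w i \<bullet> x) *\<^sub>R f i)" for x
  define W where "W x = A x - A' (x - F x)" for x
  have adjoint: "x \<bullet> A' y = A x \<bullet> y" for x y
    by (simp add: A_def A'_def inner_sum_left inner_sum_right inner_commute mult.commute)
  have "A x \<bullet> F y + F x \<bullet> A y = 0" for x y
  proof -
    have "A x \<bullet> F y = (\<Sum>i\<in>I. \<Sum>j\<in>I. (f i \<bullet> x) * (f j \<bullet> y) * (w i \<bullet> d j))"
      and "F x \<bullet> A y = (\<Sum>i\<in>I. \<Sum>j\<in>I. (f i \<bullet> x) * (f j \<bullet> y) * (d i \<bullet> w j))"
      unfolding A_def F_def inner_sum_left
      by (simp_all add: inner_sum_right sum_distrib_left mult_ac)
    then have "A x \<bullet> F y + F x \<bullet> A y =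
        (\<Sum>i\<in>I. \<Sum>j\<in>I. (f i \<bullet> x) * (f j \<bullet> y) * (w i \<bullet> d j + d i \<bullet> w j))"
      by (simp add: sum.distrib distrib_left)
    then show ?thesis by (simp add: skew)
  qed
  moreover have "x \<bullet> W y + W x \<bullet> y = A x \<bullet> F y + F x \<bullet> A y" for x y
    using adjoint[of y "x - F x"]
    by (simp add: W_def adjoint inner_commute algebra_simps)
  moreover have "bounded_linear W"
    unfolding W_def A_def A'_def F_def by (intro bounded_linear_intros)
  ultimately have "skew W" by (simp add: skew_def eq_neg_iff_add_eq_0 bounded_linear.linear)
  moreover have "W (d k) = w k" if "k \<in> I" for k
  proof -
    have "A (d k) = (\<Sum>i\<in>I. if i = k then w k else 0)" "F (d k) = (\<Sum>i\<in>I. if i = k then d k else 0)"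
      unfolding A_def F_def by (intro sum.cong refl; use dual that in auto)+
    then show ?thesis using \<open>finite I\<close> that by (simp add: W_def A'_def)
  qed
  ultimately show ?thesis by (rule that)
qed

lemma preserves_length_polarized:
  assumes "preserves_length p u i j" "preserves_length p u i c" "preserves_length p u j c"
  shows "(u i - u c) \<bullet> (p j - p c) + (p i - p c) \<bullet> (u j - u c) = 0"
proof -
  have "(u i - u c) \<bullet> (p j - p c) + (p i - p c) \<bullet> (u j - u c) =
      (u i - u c) \<bullet> (p i - p c) + (u j - u c) \<bullet> (p j - p c) - (u i - u j) \<bullet> (p i - p j)"
    by (simp add: algebra_simps inner_commute)
  then show ?thesis using assms by (simp add: preserves_length_def)
qed

lemma infinitesimal_isometry_extension:
  fixes p u :: "'v \<Rightarrow> 'a::euclidean_space"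
  assumes "inj_on p I" and affine: "\<not> affine_dependent (p ` I)" and c: "c \<in> I"
    and lengths: "\<And>i j. i \<in> I \<Longrightarrow> j \<in> I \<Longrightarrow> preserves_length p u i j"
  obtains f where "infinitesimal_isometry f" "\<And>i. i \<in> I \<Longrightarrow> f (p i) = u i"
proof -
  define d w where "d i = p i - p c" and "w i = u i - u c" for i
  have "finite I"
    using aff_independent_finite[OF affine] \<open>inj_on p I\<close> by (simp add: finite_image_iff)
  have inj: "inj_on d (I - {c})"
    using \<open>inj_on p I\<close> by (auto simp: d_def inj_on_def)
  have "p ` I = insert (p c) (p ` (I - {c}))" "p c \<notin> p ` (I - {c})"
    using c \<open>inj_on p I\<close> by (auto simp: inj_on_def)
  then have "\<not> dependent ((\<lambda>x. - p c + x) ` p ` (I - {c}))"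
    using affine affine_dependent_iff_dependent by metis
  then have "independent (d ` (I - {c}))"
    by (simp add: image_image d_def)
  then obtain f where dual: "\<And>i j. i \<in> I - {c} \<Longrightarrow> j \<in> I - {c} \<Longrightarrow> f i \<bullet> d j = (if i = j then 1 else 0)"
    using dual_basis_exists[OF _ inj] by blast
  have skew: "w i \<bullet> d j + d i \<bullet> w j = 0" if "i \<in> I" "j \<in> I" for i j
    unfolding w_def d_def by (intro preserves_length_polarized lengths that c)
  obtain W where W: "skew W" "\<And>i. i \<in> I - {c} \<Longrightarrow> W (d i) = w i"
    by (rule skew_extension_if_dual_basis[of "I - {c}" f d w]) (use \<open>finite I\<close> dual skew in auto)
  define f where "f x = u c - W (p c) + W x" for x
  have "linear W" using W(1) by (simp add: skew_def)
  have "f (p i) = u i" if "i \<in> I" for i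
  proof (cases "i = c")
    case False
    then have "W (p i) - W (p c) = u i - u c"
      using W(2)[of i] that by (simp add: d_def w_def linear_diff[OF \<open>linear W\<close>])
    then show ?thesis by (simp add: f_def algebra_simps)
  qed (simp add: f_def)
  moreover have "infinitesimal_isometry f"
    using W(1) by (auto simp: infinitesimal_isometry_def f_def[abs_def])
  ultimately show ?thesis using that by blast
qed

section \<open>Golden integers\<close>

lemma tau_square: "tau * tau = tau + 1"
  by (simp add: tau_def field_simps)

lemma tau_bounds: "1 < tau" "tau < 2"
proof -
  have "1 < sqrt 5" "sqrt 5 < 3" by (simp_all add: real_less_lsqrt)
  then show "1 < tau" "tau < 2" by (simp_all add: tau_def)
qed

lemma divide_tau: "r / tau = r * (tau - 1)"
proof -
  have "r * (tau - 1) * tau = r * (tau * tau - tau)" by (simp add: algebra_simps)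
  also have "\<dots> = r" by (simp add: tau_square)
  finally show ?thesis using tau_bounds by (simp add: nonzero_divide_eq_eq)
qed

datatype golden = Golden int int

fun real_of_golden :: "golden \<Rightarrow> real" where
  "real_of_golden (Golden a b) = of_int a + of_int b * tau"

instantiation golden :: comm_ring_1
begin

definition zero_golden :: golden where "0 = Golden 0 0"

definition one_golden :: golden where "1 = Golden 1 0"

fun plus_golden :: "golden \<Rightarrow> golden \<Rightarrow> golden" where
  "Golden a b + Golden c d = Golden (a + c) (b + d)"

fun minus_golden :: "golden \<Rightarrow> golden \<Rightarrow> golden" where
  "Golden a b - Golden c d = Golden (a - c) (b - d)"

fun uminus_golden :: "golden \<Rightarrow> golden" where
  "- Golden a b = Golden (- a) (- b)"

fun times_golden :: "golden \<Rightarrow> golden \<Rightarrow> golden" where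
  "Golden a b * Golden c d = Golden (a * c + b * d) (a * d + b * c + b * d)"

instance
proof
  fix x y z :: golden
  show "x + y + z = x + (y + z)" "x * y * z = x * (y * z)" "(x + y) * z = x * z + y * z"
    by (cases x; cases y; cases z; simp add: algebra_simps)+
  show "x + y = y + x" "x * y = y * x" "x - y = x + - y"
    by (cases x; cases y; simp add: algebra_simps)+
  show "0 + x = x" "1 * x = x" "- x + x = 0"
    by (cases x; simp add: zero_golden_def one_golden_def)+
  show "(0 :: golden) \<noteq> 1" by (simp add: zero_golden_def one_golden_def)
qed

end

fun golden_norm :: "golden \<Rightarrow> int" where
  "golden_norm (Golden a b) = a * a + a * b - b * b"

lemma real_of_golden_simps [simp]:
  "real_of_golden 0 = 0"
  "real_of_golden 1 = 1"
  "real_of_golden (r + s) = real_of_golden r + real_of_golden s"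
  "real_of_golden (r - s) = real_of_golden r - real_of_golden s"
  "real_of_golden (- r) = - real_of_golden r"
  by (cases r; cases s; simp add: zero_golden_def one_golden_def algebra_simps)+

lemma real_of_golden_mult [simp]:
  "real_of_golden (r * s) = real_of_golden r * real_of_golden s"
proof (cases r; cases s)
  fix a b c d assume rs: "r = Golden a b" "s = Golden c d"
  have "real_of_golden r * real_of_golden s = a * c + (a * d + b * c) * tau + b * d * (tau * tau)"
    by (simp add: rs algebra_simps)
  then show ?thesis by (simp add: rs tau_square algebra_simps)
qed

lemma real_of_golden_nonzero:
  assumes "golden_norm r \<noteq> 0"
  shows "real_of_golden r \<noteq> 0"
proof (cases r)
  case (Golden a b)
  have "r * Golden (a + b) (- b) = Golden (golden_norm r) 0"
    by (simp add: Golden algebra_simps)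
  then have "real_of_golden r * real_of_golden (Golden (a + b) (- b)) = golden_norm r"
    by (metis add_0_right mult_zero_left of_int_0 real_of_golden.simps real_of_golden_mult)
  then show ?thesis using assms by auto
qed

section \<open>Quadruples\<close>

type_synonym 'a quad = "'a \<times> 'a \<times> 'a \<times> 'a"

fun dot :: "('a::semiring_0) quad \<Rightarrow> 'a quad \<Rightarrow> 'a" where
  "dot (a, b, c, d) (a', b', c', d') = a * a' + b * b' + c * c' + d * d'"

fun scale :: "('a::times) \<Rightarrow> 'a quad \<Rightarrow> 'a quad" where
  "scale r (a, b, c, d) = (r * a, r * b, r * c, r * d)"

fun det3 :: "('a::comm_ring) \<times> 'a \<times> 'a \<Rightarrow> 'a \<times> 'a \<times> 'a \<Rightarrow> 'a \<times> 'a \<times> 'a \<Rightarrow> 'a" where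
  "det3 (a, b, c) (a', b', c') (a'', b'', c'') =
    a * (b' * c'' - c' * b'') - b * (a' * c'' - c' * a'') + c * (a' * b'' - b' * a'')"

text \<open>\<open>dot (cross x y z) w\<close> is the determinant of the matrix with rows \<open>w, x, y, z\<close>.\<close>

fun cross :: "('a::comm_ring) quad \<Rightarrow> 'a quad \<Rightarrow> 'a quad \<Rightarrow> 'a quad" where
  "cross (a, b, c, d) (a', b', c', d') (a'', b'', c'', d'') =
    (det3 (b, c, d) (b', c', d') (b'', c'', d''), - det3 (a, c, d) (a', c', d') (a'', c'', d''),
     det3 (a, b, d) (a', b', d') (a'', b'', d''), - det3 (a, b, c) (a', b', c') (a'', b'', c''))"

lemma dot_eq_inner: "dot x y = x \<bullet> y"
  by (cases x rule: prod_cases4; cases y rule: prod_cases4) simp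

lemma scale_eq_scaleR: "scale r x = r *\<^sub>R x"
  by (cases x rule: prod_cases4) simp

lemma scale_det_eq_sum_cross:
  fixes v :: "('a::comm_ring) quad"
  shows "scale (dot (cross x y z) w) v =
    scale (dot v w) (cross x y z) - scale (dot v x) (cross y z w)
    + scale (dot v y) (cross z w x) - scale (dot v z) (cross w x y)"
  by (cases x rule: prod_cases4; cases y rule: prod_cases4; cases z rule: prod_cases4;
      cases w rule: prod_cases4; cases v rule: prod_cases4) (simp add: algebra_simps)

lemma orthogonal_to_quadruple_zero:
  fixes v :: "real quad"
  assumes "v \<bullet> x = 0" "v \<bullet> y = 0" "v \<bullet> z = 0" "v \<bullet> w = 0" and det: "cross x y z \<bullet> w \<noteq> 0"
  shows "v = 0"
  using scale_det_eq_sum_cross[of x y z w v] assms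
  by (simp add: dot_eq_inner scale_eq_scaleR)

lemma independent_if_cross_nonzero:
  fixes x y z w :: "real quad"
  assumes det: "cross x y z \<bullet> w \<noteq> 0"
  shows "independent {x, y, z, w}"
    and "card {x, y, z, w} = 4"
proof -
  have span: "span {x, y, z, w} = UNIV"
  proof (rule ccontr)
    assume "span {x, y, z, w} \<noteq> UNIV"
    then obtain v where "v \<noteq> 0" "\<And>a. a \<in> span {x, y, z, w} \<Longrightarrow> v \<bullet> a = 0"
      using span_not_UNIV_orthogonal by blast
    then show False
      using orthogonal_to_quadruple_zero[OF _ _ _ _ det, of v] by (simp add: span_base)
  qed
  have dim: "dim (UNIV :: (real quad) set) = 4" by simp
  show "card {x, y, z, w} = 4"
  proof (rule antisym)
    show "4 \<le> card {x, y, z, w}"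
      using span_card_ge_dim[of "{x, y, z, w}" UNIV] span dim by simp
  qed (simp add: card_insert_if)
  then show "independent {x, y, z, w}"
    using card_le_dim_spanning[of "{x, y, z, w}" UNIV] span dim by simp
qed

lemma affine_independent_if_cross_nonzero:
  fixes x p q r s :: "real quad"
  assumes det: "cross (p - x) (q - x) (r - x) \<bullet> (s - x) \<noteq> 0"
  shows "\<not> affine_dependent {x, p, q, r, s}" and "card {x, p, q, r, s} = 5"
proof -
  have image: "(\<lambda>y. - x + y) ` {p, q, r, s} = {p - x, q - x, r - x, s - x}" by simp
  note independent = independent_if_cross_nonzero[OF det]
  have "0 \<notin> {p - x, q - x, r - x, s - x}"
    using independent(1) dependent_zero by metis
  then have new: "x \<notin> {p, q, r, s}" by auto
  then show "\<not> affine_dependent {x, p, q, r, s}"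
    using affine_dependent_iff_dependent[OF new] independent(1) image by simp
  have "4 \<le> card {p, q, r, s}"
    using card_image_le[of "{p, q, r, s}" "\<lambda>y. - x + y"] independent(2) unfolding image by simp
  moreover have "card {p, q, r, s} \<le> 4" by (simp add: card_insert_if)
  ultimately show "card {x, p, q, r, s} = 5" using new by simp
qed

fun real_quad :: "golden quad \<Rightarrow> real quad" where
  "real_quad (a, b, c, d) = (real_of_golden a, real_of_golden b, real_of_golden c, real_of_golden d)"

lemma real_quad_simps [simp]:
  "real_quad 0 = 0"
  "real_quad (x + y) = real_quad x + real_quad y"
  "real_quad (x - y) = real_quad x - real_quad y"
  "real_quad (scale r x) = real_of_golden r *\<^sub>R real_quad x"
  by (cases x rule: prod_cases4; cases y rule: prod_cases4; simp add: zero_prod_def)+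

lemma real_quad_sum_list: "real_quad (sum_list xs) = sum_list (map real_quad xs)"
  by (induction xs) simp_all

lemma real_of_golden_dot: "real_of_golden (dot x y) = real_quad x \<bullet> real_quad y"
  by (cases x rule: prod_cases4; cases y rule: prod_cases4) simp

lemma real_quad_cross: "real_quad (cross x y z) = cross (real_quad x) (real_quad y) (real_quad z)"
  by (cases x rule: prod_cases4; cases y rule: prod_cases4; cases z rule: prod_cases4) simp

section \<open>The snub 24-cell\<close>

fun flip :: "('a::uminus) quad \<Rightarrow> 'a quad" where
  "flip (a, b, c, d) = (- a, b, c, d)"

fun cycle :: "'a quad \<Rightarrow> 'a quad" where
  "cycle (a, b, c, d) = (b, c, a, d)"

fun double_swap :: "'a quad \<Rightarrow> 'a quad" where
  "double_swap (a, b, c, d) = (b, a, d, c)"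

definition cycles :: "('a quad \<Rightarrow> 'a quad) list" where
  "cycles = [id, cycle, cycle \<circ> cycle]"

definition even_permutations :: "('a quad \<Rightarrow> 'a quad) list" where
  "even_permutations = [c \<circ> k. k \<leftarrow> id # map ((\<circ>) double_swap) cycles, c \<leftarrow> cycles]"

text \<open>The last coordinate keeps its sign, as it vanishes for the vertex \<open>base\<close>.\<close>

definition sign_changes :: "(('a::uminus) quad \<Rightarrow> 'a quad) list" where
  "sign_changes = [f \<circ> g \<circ> h. f \<leftarrow> [id, flip], g \<leftarrow> [id, cycle \<circ> cycle \<circ> flip \<circ> cycle],
     h \<leftarrow> [id, cycle \<circ> flip \<circ> cycle \<circ> cycle]]"

definition base :: "golden quad" where
  "base = (Golden 0 1, Golden 1 0, Golden (-1) 1, Golden 0 0)"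

definition V96 :: "golden quad list" where
  "V96 = [p (s base). s \<leftarrow> sign_changes, p \<leftarrow> even_permutations]"

definition C24 :: "golden quad list" where
  "C24 = concat [[(x, 0, 0, 0), (0, x, 0, 0), (0, 0, x, 0), (0, 0, 0, x)]. x \<leftarrow> [Golden 2 0, Golden (-2) 0]] @
    [(q, r, s, t). q \<leftarrow> [1, -1], r \<leftarrow> [1, -1], s \<leftarrow> [1, -1], t \<leftarrow> [1, -1]]"

text \<open>Evaluation by rewriting computes both operands of a connective, but only the chosen branch
  of a conditional.\<close>

lemma short_circuit [code_unfold]:
  "A \<and> B \<longleftrightarrow> (if A then B else False)"
  "A \<or> B \<longleftrightarrow> (if A then True else B)"
  "(A \<longrightarrow> B) \<longleftrightarrow> (if A then B else True)"
  by simp_all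

lemma distinct_V96: "distinct V96"
  by code_simp

lemma length_V96: "length V96 = 96"
  by code_simp

lemma base_in_V96: "base \<in> set V96"
  by code_simp

lemma V96_invariant:
  "flip ` set V96 = set V96" "cycle ` set V96 = set V96" "double_swap ` set V96 = set V96"
  by code_simp+

lemma C24_invariant:
  "flip ` set C24 = set C24" "cycle ` set C24 = set C24" "double_swap ` set C24 = set C24"
  by code_simp+

definition symmetry :: "(golden quad \<Rightarrow> golden quad) \<Rightarrow> bool" where
  "symmetry g \<longleftrightarrow> g ` set V96 = set V96 \<and> g ` set C24 = set C24 \<and>
    (\<forall>x y. dot (g x) (g y) = dot x y) \<and>
    (\<exists>h. orthogonal_transformation h \<and> (\<forall>x. real_quad (g x) = h (real_quad x)))"

lemma symmetry_image_V96: "symmetry g \<Longrightarrow> g ` set V96 = set V96"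
  and symmetry_image_C24: "symmetry g \<Longrightarrow> g ` set C24 = set C24"
  and symmetry_dot: "symmetry g \<Longrightarrow> dot (g x) (g y) = dot x y"
  and symmetry_orthogonal_transformation:
    "symmetry g \<Longrightarrow> \<exists>h. orthogonal_transformation h \<and> (\<forall>x. real_quad (g x) = h (real_quad x))"
  by (simp_all only: symmetry_def)

lemma symmetry_id: "symmetry id"
  by (auto simp: symmetry_def intro!: exI[of _ "\<lambda>x. x"])

lemma symmetry_comp:
  assumes "symmetry f" "symmetry g"
  shows "symmetry (f \<circ> g)"
proof -
  obtain h k where orthogonal: "orthogonal_transformation h" "orthogonal_transformation k"
    and real: "\<And>x. real_quad (f x) = h (real_quad x)" "\<And>x. real_quad (g x) = k (real_quad x)"
    using assms[THEN symmetry_orthogonal_transformation] by blast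
  show ?thesis
    unfolding symmetry_def image_comp[symmetric]
    by (intro conjI allI exI[of _ "h \<circ> k"])
      (simp_all only: assms[THEN symmetry_image_V96] assms[THEN symmetry_image_C24]
        assms[THEN symmetry_dot] real comp_apply orthogonal_transformation_compose[OF orthogonal])
qed

lemma dot_flip: "dot (flip x) (flip y) = dot x y" for x y :: "('a::comm_ring) quad"
  by (cases x rule: prod_cases4; cases y rule: prod_cases4) simp

lemma dot_cycle: "dot (cycle x) (cycle y) = dot x y" for x y :: "('a::comm_ring) quad"
  by (cases x rule: prod_cases4; cases y rule: prod_cases4) (simp add: ac_simps)

lemma dot_double_swap: "dot (double_swap x) (double_swap y) = dot x y" for x y :: "('a::comm_ring) quad"
  by (cases x rule: prod_cases4; cases y rule: prod_cases4) (simp add: ac_simps)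

lemma linear_flip: "linear (flip :: real quad \<Rightarrow> real quad)"
  and linear_cycle: "linear (cycle :: real quad \<Rightarrow> real quad)"
  and linear_double_swap: "linear (double_swap :: real quad \<Rightarrow> real quad)"
  by (auto intro!: linearI)

lemma symmetryI:
  assumes "g ` set V96 = set V96" "g ` set C24 = set C24" "\<And>x y. dot (g x) (g y) = dot x y"
    and "linear h" "\<And>a b. dot (h a) (h b) = dot a b" "\<And>x. real_quad (g x) = h (real_quad x)"
  shows "symmetry g"
proof -
  have "orthogonal_transformation h"
    using assms(4,5) unfolding orthogonal_transformation_def dot_eq_inner by blast
  then show ?thesis
    unfolding symmetry_def using assms(6) by (intro conjI exI[of _ h] allI assms(1-3))
qed

lemma symmetry_flip: "symmetry flip"
  and symmetry_cycle: "symmetry cycle"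
  and symmetry_double_swap: "symmetry double_swap"
proof -
  have real: "real_quad (flip x) = flip (real_quad x)" "real_quad (cycle x) = cycle (real_quad x)"
    "real_quad (double_swap x) = double_swap (real_quad x)" for x
    by (cases x rule: prod_cases4; simp)+
  show "symmetry flip"
    by (rule symmetryI[OF V96_invariant(1) C24_invariant(1) dot_flip linear_flip dot_flip real(1)])
  show "symmetry cycle"
    by (rule symmetryI[OF V96_invariant(2) C24_invariant(2) dot_cycle linear_cycle dot_cycle real(2)])
  show "symmetry double_swap"
    by (rule symmetryI[OF V96_invariant(3) C24_invariant(3) dot_double_swap linear_double_swap
          dot_double_swap real(3)])
qed

lemma symmetry_even_permutation: "p \<in> set even_permutations \<Longrightarrow> symmetry p"
  and symmetry_sign_change: "s \<in> set sign_changes \<Longrightarrow> symmetry s"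
proof -
  note symmetry_intros = symmetry_id symmetry_flip symmetry_cycle symmetry_double_swap symmetry_comp
  have "\<forall>p\<in>set even_permutations. symmetry p"
    by (simp add: even_permutations_def cycles_def symmetry_intros)
  then show "p \<in> set even_permutations \<Longrightarrow> symmetry p" by blast
  have "\<forall>s\<in>set sign_changes. symmetry s"
    by (simp add: sign_changes_def symmetry_intros)
  then show "s \<in> set sign_changes \<Longrightarrow> symmetry s" by blast
qed

lemma V96_transitive:
  assumes "x \<in> set V96"
  obtains g where "symmetry g" "x = g base"
proof -
  obtain p s where "x = (p \<circ> s) base" "p \<in> set even_permutations" "s \<in> set sign_changes"
    using assms by (auto simp: V96_def)
  then show ?thesis
    using that symmetry_comp[OF symmetry_even_permutation symmetry_sign_change] by blast
qed

lemma V96_pair_transitive: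
  assumes "x \<in> set V96" "y \<in> S" and "\<And>g. symmetry g \<Longrightarrow> g ` S = S"
  obtains g z where "symmetry g" "x = g base" "y = g z" "z \<in> S"
  using V96_transitive[OF assms(1)] assms(2,3) by (metis imageE)

section \<open>Self-stresses\<close>

definition adjacent :: "golden quad \<Rightarrow> golden quad \<Rightarrow> bool" where
  "adjacent x y \<longleftrightarrow> dot x y = Golden 0 2"

definition diagonal :: "golden quad \<Rightarrow> golden quad \<Rightarrow> bool" where
  "diagonal x y \<longleftrightarrow> dot x y = Golden 2 0 \<and> (\<exists>c\<in>set C24. adjacent c x \<and> adjacent c y)"

lemma adjacent_symmetry: "symmetry g \<Longrightarrow> adjacent (g x) (g y) \<longleftrightarrow> adjacent x y"
  by (simp only: adjacent_def symmetry_dot[of g])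

lemma diagonal_symmetry:
  assumes "symmetry g"
  shows "diagonal (g x) (g y) \<longleftrightarrow> diagonal x y"
proof -
  have "(\<exists>c\<in>set C24. adjacent c (g x) \<and> adjacent c (g y)) \<longleftrightarrow>
      (\<exists>c\<in>g ` set C24. adjacent c (g x) \<and> adjacent c (g y))"
    by (simp only: symmetry_image_C24[OF assms])
  then show ?thesis
    by (simp add: diagonal_def adjacent_symmetry[OF assms] symmetry_dot[OF assms])
qed

definition motion :: "(golden quad \<Rightarrow> real quad) \<Rightarrow> bool" where
  "motion u \<longleftrightarrow>
    (\<forall>x\<in>set V96. \<forall>y\<in>set V96. adjacent x y \<longrightarrow> preserves_length real_quad u x y)"

definition implied :: "golden quad \<Rightarrow> golden quad \<Rightarrow> bool" where
  "implied x y \<longleftrightarrow> (\<forall>u. motion u \<longrightarrow> preserves_length real_quad u x y)"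

lemma implied_if_adjacent: "x \<in> set V96 \<Longrightarrow> y \<in> set V96 \<Longrightarrow> adjacent x y \<Longrightarrow> implied x y"
  by (simp add: implied_def motion_def)

lemma implied_symmetry:
  assumes "symmetry g" and "implied x y"
  shows "implied (g x) (g y)"
  unfolding implied_def
proof (intro allI impI)
  fix u assume "motion u"
  obtain h where h: "orthogonal_transformation h" "\<And>x. real_quad (g x) = h (real_quad x)"
    using symmetry_orthogonal_transformation[OF assms(1)] by blast
  have inner: "h a \<bullet> h b = a \<bullet> b" for a b
    using h(1) unfolding orthogonal_transformation_def by blast
  define v where "v x = inv h (u (g x))" for x
  have "(v x - v y) \<bullet> (real_quad x - real_quad y) =
      (u (g x) - u (g y)) \<bullet> (real_quad (g x) - real_quad (g y))" for x y
  proof -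
    have "(v x - v y) \<bullet> (real_quad x - real_quad y) =
        h (v x - v y) \<bullet> h (real_quad x - real_quad y)"
      by (simp only: inner)
    also have "\<dots> = (u (g x) - u (g y)) \<bullet> (real_quad (g x) - real_quad (g y))"
      using h by (simp add: v_def linear_diff orthogonal_transformation_linear
          surj_f_inv_f orthogonal_transformation_surj)
    finally show ?thesis .
  qed
  then have transport: "preserves_length real_quad v x y \<longleftrightarrow> preserves_length real_quad u (g x) (g y)" for x y
    by (simp add: preserves_length_def)
  have "g x \<in> set V96" if "x \<in> set V96" for x
    using symmetry_image_V96[OF assms(1)] that by blast
  then have "motion v"
    using \<open>motion u\<close> assms(1) by (simp add: motion_def transport adjacent_symmetry)
  then show "preserves_length real_quad u (g x) (g y)"
    using \<open>implied x y\<close> transport unfolding implied_def by blast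
qed

definition self_stress :: "(golden quad \<Rightarrow> golden quad \<Rightarrow> golden) \<Rightarrow> golden quad list \<Rightarrow> bool" where
  "self_stress w L \<longleftrightarrow>
    (\<forall>x\<in>set L. (\<Sum>y\<leftarrow>L. scale (w x y) (y - x)) = 0 \<and> (\<forall>y\<in>set L. w y x = w x y))"

definition resolves :: "(golden quad \<Rightarrow> golden quad \<Rightarrow> golden) \<Rightarrow>
    (golden quad \<Rightarrow> golden quad \<Rightarrow> bool) \<Rightarrow> golden quad list \<Rightarrow> golden quad \<Rightarrow> golden quad \<Rightarrow> bool" where
  "resolves w bar L p q \<longleftrightarrow> self_stress w L \<and> p \<in> set L \<and> q \<in> set L \<and> golden_norm (w p q) \<noteq> 0 \<and>
    (\<forall>x\<in>set L. \<forall>y\<in>set L. w x y = 0 \<or> x = p \<and> y = q \<or> x = q \<and> y = p \<or> bar x y)"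

lemma implied_if_resolves:
  assumes resolves: "resolves w bar L p q" and "distinct L"
    and bars: "\<And>x y. x \<in> set L \<Longrightarrow> y \<in> set L \<Longrightarrow> bar x y \<Longrightarrow> implied x y"
  shows "implied p q"
  unfolding implied_def
proof (intro allI impI)
  fix u assume "motion u"
  show "preserves_length real_quad u p q"
  proof (rule preserves_length_if_self_stress)
    show "p \<in> set L" "q \<in> set L" "real_of_golden (w p q) \<noteq> 0"
      using resolves real_of_golden_nonzero by (auto simp: resolves_def)
    fix x assume x: "x \<in> set L"
    have "(\<Sum>y\<leftarrow>L. scale (w x y) (y - x)) = 0"
      using resolves x by (simp add: resolves_def self_stress_def)
    then have "sum_list (map real_quad (map (\<lambda>y. scale (w x y) (y - x)) L)) = 0"
      by (simp only: real_quad_sum_list[symmetric] real_quad_simps)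
    then show "(\<Sum>y\<in>set L. real_of_golden (w x y) *\<^sub>R (real_quad y - real_quad x)) = 0"
      using \<open>distinct L\<close> by (simp add: comp_def sum_list_distinct_conv_sum_set)
    fix y assume y: "y \<in> set L"
    show "real_of_golden (w y x) = real_of_golden (w x y)"
      using resolves x y by (simp add: resolves_def self_stress_def)
    have "w x y = 0 \<or> bar x y \<or> {x, y} = {p, q}"
      using resolves x y unfolding resolves_def by blast
    then show "real_of_golden (w x y) = 0 \<or> preserves_length real_quad u x y \<or> {x, y} = {p, q}"
      using bars[OF x y] \<open>motion u\<close> by (auto simp: implied_def)
  qed simp
qed

definition symmetric_lookup :: "(('k \<times> 'k) \<times> golden) list \<Rightarrow> 'k \<Rightarrow> 'k \<Rightarrow> golden" where
  "symmetric_lookup table a b = (case map_of table (a, b) of Some r \<Rightarrow> r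
     | None \<Rightarrow> (case map_of table (b, a) of Some r \<Rightarrow> r | None \<Rightarrow> 0))"

text \<open>A self-stress of an icosahedral cell with one diagonal \<open>pq\<close> added. The weights are constant on the
  orbits of the stabiliser of \<open>{p, q}\<close>, which are told apart by the products with \<open>p + q\<close>.\<close>

definition ico_stress :: "golden quad \<Rightarrow> golden quad \<Rightarrow> golden quad \<Rightarrow> golden quad \<Rightarrow> golden" where
  "ico_stress p q x y =
    (if adjacent x y \<or> x = p \<and> y = q \<or> x = q \<and> y = p then
       symmetric_lookup
         [((Golden (-2) 4, Golden 2 2), Golden 2 1), ((Golden (-2) 4, Golden 4 0), Golden (-3) 1),
          ((Golden (-2) 4, Golden 6 0), Golden 2 (-4)), ((Golden 0 4, Golden 0 4), Golden 12 6),
          ((Golden 0 4, Golden 2 2), Golden (-3) 6), ((Golden 0 4, Golden 6 0), Golden (-3) (-9)),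
          ((Golden 2 2, Golden 2 2), Golden 2 (-4)), ((Golden 2 2, Golden 4 0), Golden 7 (-4)),
          ((Golden 2 2, Golden 6 0), Golden (-8) 1), ((Golden 4 0, Golden 4 0), Golden (-8) 6),
          ((Golden 6 0, Golden 6 0), Golden 20 0)]
         (dot x (p + q)) (dot y (p + q))
     else 0)"

lemma ico_stress_base:
  "\<forall>c\<in>set C24. adjacent c base \<longrightarrow> (\<forall>q\<in>set V96. dot base q = Golden 2 0 \<and> adjacent c q \<longrightarrow>
      resolves (ico_stress base q) adjacent (filter (adjacent c) V96) base q)"
  by code_simp

lemma implied_if_diagonal:
  assumes "x \<in> set V96" "y \<in> set V96" "diagonal x y"
  shows "implied x y"
proof -
  obtain g q where g: "symmetry g" "x = g base" "y = g q" and q: "q \<in> set V96"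
    using V96_pair_transitive[OF assms(1,2) symmetry_image_V96] by blast
  then have "diagonal base q" using assms(3) diagonal_symmetry by blast
  then obtain c where c: "c \<in> set C24" "adjacent c base" "adjacent c q" "dot base q = Golden 2 0"
    unfolding diagonal_def by blast
  then have "resolves (ico_stress base q) adjacent (filter (adjacent c) V96) base q"
    using ico_stress_base c q by blast
  then have "implied base q"
    by (rule implied_if_resolves) (simp_all add: distinct_V96 implied_if_adjacent)
  then show ?thesis using g implied_symmetry by simp
qed

text \<open>The stress for the pairs with \<open>p \<bullet> q = 2\<close> that are not in a common icosahedral cell: it uses the
  three common neighbours of \<open>p\<close> and \<open>q\<close> and six vertices with product 2 with both.\<close>

definition bipyramid_stress :: "golden quad \<Rightarrow> golden quad \<Rightarrow> golden quad \<Rightarrow> golden quad \<Rightarrow> golden" where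
  "bipyramid_stress p q x y =
    (if adjacent x y then
       symmetric_lookup
         [((Golden 0 4, Golden 0 4), Golden 0 1), ((Golden 4 0, Golden 4 0), Golden 2 (-1)),
          ((Golden 6 0, Golden 0 4), Golden 0 (-2))]
         (dot x (p + q)) (dot y (p + q))
     else if dot x y = Golden 2 0 then
       symmetric_lookup
         [((Golden 6 0, Golden 6 0), Golden 6 0), ((Golden 0 4, Golden 4 0), Golden (-1) 1),
          ((Golden 6 0, Golden 4 0), Golden (-2) 1)]
         (dot x (p + q)) (dot y (p + q))
     else 0)"

lemma bipyramid_stress_base:
  "\<forall>q\<in>set V96. dot base q = Golden 2 0 \<and> \<not> diagonal base q \<longrightarrow>
    resolves (bipyramid_stress base q) (\<lambda>x y. adjacent x y \<or> diagonal x y)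
      (filter (\<lambda>x. dot x (base + q) \<in> {Golden 6 0, Golden 0 4, Golden 4 0}) V96) base q"
  by code_simp

lemma implied_if_dot_eq_2:
  assumes "x \<in> set V96" "y \<in> set V96" "dot x y = Golden 2 0"
  shows "implied x y"
proof -
  obtain g q where g: "symmetry g" "x = g base" "y = g q" and q: "q \<in> set V96"
    using V96_pair_transitive[OF assms(1,2) symmetry_image_V96] by blast
  have dot: "dot base q = Golden 2 0" using assms(3) symmetry_dot[OF g(1)] g(2,3) by simp
  have "implied base q"
  proof (cases "diagonal base q")
    case True
    then show ?thesis using implied_if_diagonal base_in_V96 q by blast
  next
    case False
    then have "resolves (bipyramid_stress base q) (\<lambda>x y. adjacent x y \<or> diagonal x y)
        (filter (\<lambda>x. dot x (base + q) \<in> {Golden 6 0, Golden 0 4, Golden 4 0}) V96) base q"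
      using bipyramid_stress_base q dot by blast
    then show ?thesis
    proof (rule implied_if_resolves)
      fix x y assume "adjacent x y \<or> diagonal x y"
        and "x \<in> set (filter (\<lambda>x. dot x (base + q) \<in> {Golden 6 0, Golden 0 4, Golden 4 0}) V96)"
        and "y \<in> set (filter (\<lambda>x. dot x (base + q) \<in> {Golden 6 0, Golden 0 4, Golden 4 0}) V96)"
      then show "implied x y" using implied_if_adjacent implied_if_diagonal by (meson filter_is_subset subsetD)
    qed (simp add: distinct_V96)
  qed
  then show ?thesis using g implied_symmetry by simp
qed

lemma implied_if_dot_in:
  assumes "x \<in> set V96" "y \<in> set V96" "dot x y \<in> {Golden 0 2, Golden 2 0}"
  shows "implied x y"
  using assms(3) implied_if_adjacent[OF assms(1,2)] implied_if_dot_eq_2[OF assms(1,2)]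
  by (auto simp: adjacent_def)

section \<open>Rigidity of the snub 24-cell\<close>

definition pinned :: "golden quad \<Rightarrow> golden quad \<Rightarrow> golden quad \<Rightarrow> golden quad \<Rightarrow> golden quad \<Rightarrow> bool" where
  "pinned x p q r s \<longleftrightarrow> (\<forall>y\<in>{p, q, r, s}. dot x y \<in> {Golden 0 2, Golden 2 0}) \<and>
     golden_norm (dot (cross (p - x) (q - x) (r - x)) (s - x)) \<noteq> 0"

lemma pinned_cross_nonzero:
  assumes "pinned x p q r s"
  shows "cross (real_quad p - real_quad x) (real_quad q - real_quad x) (real_quad r - real_quad x)
    \<bullet> (real_quad s - real_quad x) \<noteq> 0"
proof -
  have "real_of_golden (dot (cross (p - x) (q - x) (r - x)) (s - x)) \<noteq> 0"
    using assms by (intro real_of_golden_nonzero) (simp add: pinned_def)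
  then show ?thesis by (simp add: real_of_golden_dot real_quad_cross)
qed

lemma zero_if_pinned:
  assumes "motion u" and "pinned x p q r s"
    and "x \<in> set V96" "{p, q, r, s} \<subseteq> set V96" and "\<And>y. y \<in> {p, q, r, s} \<Longrightarrow> u y = 0"
  shows "u x = 0"
proof (rule orthogonal_to_quadruple_zero[OF _ _ _ _ pinned_cross_nonzero])
  have "u x \<bullet> (real_quad y - real_quad x) = 0" if y: "y \<in> {p, q, r, s}" for y
  proof -
    have "implied x y" using assms(2-4) y by (intro implied_if_dot_in) (auto simp: pinned_def)
    then have "(u x - u y) \<bullet> (real_quad x - real_quad y) = 0"
      using \<open>motion u\<close> by (simp add: implied_def preserves_length_def)
    then show ?thesis using assms(5)[OF y] by (simp add: inner_diff_right)
  qed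
  then show "u x \<bullet> (real_quad p - real_quad x) = 0" "u x \<bullet> (real_quad q - real_quad x) = 0"
    "u x \<bullet> (real_quad r - real_quad x) = 0" "u x \<bullet> (real_quad s - real_quad x) = 0"
    by simp_all
qed fact

fun spreads :: "golden quad list \<Rightarrow> nat list \<Rightarrow> (nat \<times> nat quad) list \<Rightarrow> bool" where
  "spreads V K [] \<longleftrightarrow> (\<forall>i\<in>{0..<length V}. i \<in> set K)"
| "spreads V K ((i, a, b, c, d) # cs) \<longleftrightarrow> i < length V \<and> (\<forall>j\<in>{a, b, c, d}. j < length V \<and> j \<in> set K) \<and>
     pinned (V ! i) (V ! a) (V ! b) (V ! c) (V ! d) \<and> spreads V (i # K) cs"

lemma zero_if_spreads:
  assumes "motion u" and "spreads V96 K cs" and "\<And>i. i \<in> set K \<Longrightarrow> i < length V96 \<Longrightarrow> u (V96 ! i) = 0"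
    and "x \<in> set V96"
  shows "u x = 0"
  using assms(2-4)
proof (induction V96 K cs rule: spreads.induct)
  case (1 K)
  then show ?case by (auto simp: in_set_conv_nth)
next
  case (2 K j a b c d cs)
  have "u (V96 ! j) = 0"
    by (rule zero_if_pinned[OF \<open>motion u\<close>, of _ "V96 ! a" "V96 ! b" "V96 ! c" "V96 ! d"])
      (use 2 in auto)
  then show ?case using 2 by auto
qed

text \<open>Found by greedy search: each entry lists a vertex and four vertices pinning it, all of them
  initial or occurring earlier.\<close>

definition spreading :: "(nat \<times> nat quad) list" where
  "spreading = [
    (9,15,0,1,2), (11,15,0,1,2), (12,15,0,2,3), (4,0,1,2,12), (6,0,2,3,12), (14,15,1,2,3),
    (5,0,1,2,14), (8,1,2,3,14), (13,0,1,4,5), (7,0,1,3,13), (10,0,1,2,13), (16,15,0,1,9),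
    (17,15,0,2,11), (18,3,11,6,14), (19,3,9,12,4), (20,4,6,5,8), (21,0,9,12,6), (22,1,11,14,5),
    (23,15,2,3,9), (24,0,1,9,4), (25,1,2,11,5), (26,15,0,2,3), (27,2,3,11,6), (28,0,3,9,12),
    (29,1,4,5,10), (30,9,4,6,7), (31,11,6,5,8), (32,3,9,11,6), (33,15,0,1,3), (34,0,1,2,4),
    (35,15,0,2,3), (36,9,12,4,19), (37,5,13,10,20), (38,15,3,11,18), (39,15,2,11,17), (40,15,0,9,12),
    (41,1,13,10,16), (42,8,7,18,22), (43,6,8,18,23), (44,6,7,18,21), (45,0,12,4,13), (46,1,14,5,13),
    (47,15,2,3,12), (48,11,14,5,17), (49,15,3,9,12), (50,4,13,10,16), (51,4,13,7,19), (52,14,5,8,20),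
    (53,3,12,6,18), (54,15,0,2,12), (55,15,0,1,13), (56,15,1,2,14), (57,11,14,8,23), (58,9,12,6,21),
    (59,13,7,10,22), (60,14,18,23,27), (61,12,19,21,28), (62,13,20,22,29), (63,13,16,21,24), (64,14,17,22,25),
    (65,15,12,23,26), (66,15,14,17,35), (67,15,12,16,33), (68,13,16,17,34), (69,18,20,22,31), (70,18,19,23,32),
    (71,19,20,21,30), (72,22,25,29,31), (73,23,26,27,32), (74,21,24,28,30), (75,20,29,30,31), (76,18,27,31,32),
    (77,19,28,30,32), (78,16,24,33,34), (79,17,25,34,35), (80,15,26,33,35), (81,14,25,27,35), (82,12,26,28,33),
    (83,13,24,29,34), (84,42,43,52,60), (85,43,44,53,60), (86,42,44,51,61), (87,37,41,50,62), (88,38,39,48,60),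
    (89,36,40,49,61), (90,41,46,55,62), (91,39,47,54,60), (92,40,45,54,61), (93,37,46,48,60), (94,38,47,49,60),
    (95,36,45,50,61)]"

lemma spreads_spreading: "spreads V96 [15, 0, 1, 2, 3] spreading"
  by code_simp

lemma initial_pinned: "pinned (V96 ! 15) (V96 ! 0) (V96 ! 1) (V96 ! 2) (V96 ! 3)"
  by code_simp

lemma initial_clique:
  "\<forall>i\<in>{15, 0, 1, 2, 3}. \<forall>j\<in>{15, 0, 1, 2, 3}. i = j \<or> dot (V96 ! i) (V96 ! j) \<in> {Golden 0 2, Golden 2 0}"
  by code_simp

lemma motion_extends_on_initial_simplex:
  assumes "motion u"
  obtains f where "infinitesimal_isometry f"
    "\<And>i. i \<in> {15, 0, 1, 2, 3} \<Longrightarrow> f (real_quad (V96 ! i)) = u (V96 ! i)"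
proof -
  define I where "I = {15, 0, 1, 2, 3 :: nat}"
  define p where "p i = real_quad (V96 ! i)" for i
  have image: "p ` I = {p 15, p 0, p 1, p 2, p 3}" by (simp add: I_def)
  note simplex = affine_independent_if_cross_nonzero[OF pinned_cross_nonzero[OF initial_pinned],
      folded p_def, folded image]
  have "card (p ` I) = card I" unfolding simplex(2) by (simp add: I_def)
  then have "inj_on p I" by (rule eq_card_imp_inj_on[rotated]) (simp add: I_def)
  moreover have "preserves_length p (\<lambda>i. u (V96 ! i)) i j" if "i \<in> I" "j \<in> I" for i j
  proof (cases "i = j")
    case False
    have "i < length V96" "j < length V96" using that by (auto simp: I_def length_V96)
    moreover have "dot (V96 ! i) (V96 ! j) \<in> {Golden 0 2, Golden 2 0}"
      using bspec[OF bspec[OF initial_clique that(1)[unfolded I_def]] that(2)[unfolded I_def]]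
      by (simp only: False simp_thms)
    ultimately have "implied (V96 ! i) (V96 ! j)" by (simp only: implied_if_dot_in nth_mem)
    then show ?thesis using assms by (simp add: implied_def preserves_length_def p_def)
  qed (simp add: preserves_length_def)
  moreover have "0 \<in> I" by (simp add: I_def)
  ultimately obtain f where f: "infinitesimal_isometry f" "\<And>i. i \<in> I \<Longrightarrow> f (p i) = u (V96 ! i)"
    using infinitesimal_isometry_extension[OF _ simplex(1)] by blast
  show ?thesis by (rule that[OF f(1) f(2)[unfolded I_def p_def]])
qed

lemma motion_minus_infinitesimal_isometry:
  assumes "motion u" "infinitesimal_isometry f"
  shows "motion (\<lambda>x. u x - f (real_quad x))"
  unfolding motion_def
proof (intro ballI impI)
  fix x y assume "x \<in> set V96" "y \<in> set V96" "adjacent x y"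
  then have "(u x - u y) \<bullet> (real_quad x - real_quad y) = 0"
    using \<open>motion u\<close> by (simp add: motion_def preserves_length_def)
  moreover have "(f (real_quad x) - f (real_quad y)) \<bullet> (real_quad x - real_quad y) = 0"
    by (rule infinitesimal_isometry_orthogonal[OF assms(2)])
  moreover have "u x - f (real_quad x) - (u y - f (real_quad y)) =
      (u x - u y) - (f (real_quad x) - f (real_quad y))" by simp
  ultimately show "preserves_length real_quad (\<lambda>x. u x - f (real_quad x)) x y"
    by (simp only: preserves_length_def inner_diff_left)
qed

lemma motion_is_infinitesimal_isometry:
  assumes "motion u"
  obtains f where "infinitesimal_isometry f" "\<And>x. x \<in> set V96 \<Longrightarrow> u x = f (real_quad x)"
proof -
  obtain f where f: "infinitesimal_isometry f"
    "\<And>i. i \<in> {15, 0, 1, 2, 3} \<Longrightarrow> f (real_quad (V96 ! i)) = u (V96 ! i)"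
    using motion_extends_on_initial_simplex[OF assms] by blast
  have initial: "u (V96 ! i) - f (real_quad (V96 ! i)) = 0" if "i \<in> set [15, 0, 1, 2, 3]" for i
    using f(2)[of i] that by simp
  have "u x - f (real_quad x) = 0" if "x \<in> set V96" for x
    using motion_minus_infinitesimal_isometry[OF assms f(1)] spreads_spreading initial that
    by (rule zero_if_spreads)
  then show ?thesis using that[OF f(1)] by simp
qed

section \<open>Matrix-valued functions\<close>

lemma bounded_bilinear_matrix_mult:
  "bounded_bilinear ((**) :: real^'m^'n \<Rightarrow> real^'k^'m \<Rightarrow> real^'k^'n)"
  unfolding bilinear_conv_bounded_bilinear[symmetric] bilinear_def
  by (auto intro!: linearI simp: matrix_matrix_mult_def vec_eq_iff algebra_simps sum.distrib sum_distrib_left)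

lemmas has_vector_derivative_matrix_mult =
  bounded_bilinear.has_vector_derivative[OF bounded_bilinear_matrix_mult]

lemmas bounded_linear_matrix_mult_left = bounded_bilinear.bounded_linear_left[OF bounded_bilinear_matrix_mult]

lemmas bounded_linear_matrix_mult_right = bounded_bilinear.bounded_linear_right[OF bounded_bilinear_matrix_mult]

lemmas matrix_mult_simps = bounded_bilinear.add_left[OF bounded_bilinear_matrix_mult]
  bounded_bilinear.add_right[OF bounded_bilinear_matrix_mult]
  bounded_bilinear.diff_left[OF bounded_bilinear_matrix_mult]
  bounded_bilinear.diff_right[OF bounded_bilinear_matrix_mult]
  bounded_bilinear.minus_left[OF bounded_bilinear_matrix_mult]
  bounded_bilinear.minus_right[OF bounded_bilinear_matrix_mult]
  bounded_bilinear.zero_left[OF bounded_bilinear_matrix_mult]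
  bounded_bilinear.zero_right[OF bounded_bilinear_matrix_mult]

lemma bounded_linear_transpose: "bounded_linear (transpose :: real^'m^'n \<Rightarrow> real^'n^'m)"
  unfolding linear_conv_bounded_linear[symmetric]
  by (auto intro!: linearI simp: transpose_def vec_eq_iff)

lemma has_vector_derivative_vec:
  fixes f :: "real \<Rightarrow> ('a::euclidean_space)^'n"
  assumes "\<And>i. ((\<lambda>t. f t $ i) has_vector_derivative D $ i) (at t within S)"
  shows "(f has_vector_derivative D) (at t within S)"
  unfolding has_vector_derivative_def
proof (subst has_derivative_componentwise_within, rule ballI)
  fix b :: "'a^'n" assume "b \<in> Basis"
  then obtain i c where b: "b = axis i c" by (auto simp: Basis_vec_def)
  have "((\<lambda>t. f t $ i \<bullet> c) has_derivative (\<lambda>h. (h *\<^sub>R D $ i) \<bullet> c)) (at t within S)"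
    using assms[of i] unfolding has_vector_derivative_def by (rule has_derivative_inner_left)
  then show "((\<lambda>t. f t \<bullet> b) has_derivative (\<lambda>h. (h *\<^sub>R D) \<bullet> b)) (at t within S)"
    by (simp add: b inner_axis)
qed

lemma preserved_form_derivative:
  fixes p :: "real \<Rightarrow> real^'k^'n" and M :: "real^'n^'n"
  assumes p: "(p has_vector_derivative v) (at t)"
    and preserved: "((\<lambda>t. transpose (p t) ** M ** p t - C) has_vector_derivative 0) (at t)"
  shows "transpose (p t) ** M ** v + transpose v ** M ** p t = 0"
proof -
  have "((\<lambda>t. transpose (p t) ** M ** p t - C) has_vector_derivative
      (transpose (p t) ** M ** v + (transpose (p t) ** 0 + transpose v ** M) ** p t) - 0) (at t)"
    by (intro has_vector_derivative_diff has_vector_derivative_matrix_mult has_vector_derivative_const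
        bounded_linear.has_vector_derivative[OF bounded_linear_transpose] p)
  from vector_derivative_unique_at[OF this preserved] show ?thesis by (simp add: matrix_mult_simps)
qed

lemma constant_square_derivative:
  fixes p :: "real \<Rightarrow> real^'n^'n"
  assumes p: "(p has_vector_derivative v) (at t)"
    and square: "((\<lambda>t. p t ** p t - C) has_vector_derivative 0) (at t)"
  shows "p t ** v + v ** p t = 0"
proof -
  have "((\<lambda>t. p t ** p t - C) has_vector_derivative (p t ** v + v ** p t) - 0) (at t)"
    by (intro has_vector_derivative_diff has_vector_derivative_matrix_mult has_vector_derivative_const p)
  from vector_derivative_unique_at[OF this square] show ?thesis by simp
qed

section \<open>The matrix exponential\<close>

fun mat_pow :: "real^'n^'n \<Rightarrow> nat \<Rightarrow> real^'n^'n" where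
  "mat_pow X 0 = mat 1"
| "mat_pow X (Suc k) = X ** mat_pow X k"

lemma mat_pow_Suc_right: "mat_pow X (Suc k) = mat_pow X k ** X"
  by (induction k) (simp_all add: matrix_mul_assoc)

lemma norm_mat_pow_bound:
  fixes X :: "real^'n^'n"
  obtains C where "C \<ge> 0" "\<And>k. norm (mat_pow X k) \<le> norm (mat 1 :: real^'n^'n) * C ^ k"
proof -
  obtain K where K: "K \<ge> 0" "\<And>(A :: real^'n^'n) (B :: real^'n^'n). norm (A ** B) \<le> norm A * norm B * K"
    using bounded_bilinear.nonneg_bounded[OF bounded_bilinear_matrix_mult] by blast
  have "norm (mat_pow X k) \<le> norm (mat 1 :: real^'n^'n) * (norm X * K) ^ k" for k
  proof (induction k)
    case (Suc k)
    have "norm (mat_pow X (Suc k)) \<le> (norm X * K) * norm (mat_pow X k)"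
      using K(2)[of X "mat_pow X k"] by (simp add: mult_ac)
    also have "\<dots> \<le> (norm X * K) * (norm (mat 1 :: real^'n^'n) * (norm X * K) ^ k)"
      using K(1) by (intro mult_left_mono Suc.IH) simp
    finally show ?case by (simp add: mult_ac)
  qed simp
  then show ?thesis using K(1) by (intro that[of "norm X * K"]) auto
qed

lemma summable_mat_exp:
  fixes X :: "real^'n^'n"
  shows "summable (\<lambda>k. (t ^ k / fact k) *\<^sub>R mat_pow X k)"
proof -
  obtain C where C: "C \<ge> 0" "\<And>k. norm (mat_pow X k) \<le> norm (mat 1 :: real^'n^'n) * C ^ k"
    using norm_mat_pow_bound[where X = X] by blast
  have "norm ((t ^ k / fact k) *\<^sub>R mat_pow X k) \<le>
      norm (mat 1 :: real^'n^'n) * (inverse (fact k) * (\<bar>t\<bar> * C) ^ k)" for k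
  proof -
    have "norm ((t ^ k / fact k) *\<^sub>R mat_pow X k) = \<bar>t\<bar> ^ k / fact k * norm (mat_pow X k)"
      by (simp add: power_abs)
    also have "\<dots> \<le> \<bar>t\<bar> ^ k / fact k * (norm (mat 1 :: real^'n^'n) * C ^ k)"
      by (intro mult_left_mono C) simp
    finally show ?thesis by (simp add: power_mult_distrib divide_inverse mult_ac)
  qed
  then show ?thesis
    by (intro summable_comparison_test[OF _ summable_mult[OF summable_exp]]) blast
qed

definition mat_exp :: "real^'n^'n \<Rightarrow> real \<Rightarrow> real^'n^'n" where
  "mat_exp X t = (\<Sum>k. (t ^ k / fact k) *\<^sub>R mat_pow X k)"

lemma mat_exp_linear_image_sums:
  assumes "bounded_linear F"
  shows "(\<lambda>k. (t ^ k / fact k) *\<^sub>R F (mat_pow X k)) sums F (mat_exp X t)"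
  using bounded_linear.sums[OF assms summable_sums[OF summable_mat_exp]]
  by (simp add: mat_exp_def linear_scale bounded_linear.linear[OF assms])

lemma mat_exp_0 [simp]: "mat_exp X 0 = mat 1"
proof -
  have "(0 ^ k / fact k) *\<^sub>R mat_pow X k = (if k = 0 then mat 1 else 0)" for k by (cases k) auto
  then have "(\<lambda>k. (0 ^ k / fact k) *\<^sub>R mat_pow X k) sums mat 1"
    using sums_single[of 0 "\<lambda>_. mat 1"] by simp
  then show ?thesis by (simp add: mat_exp_def sums_iff)
qed

lemma mat_exp_commute: "mat_exp X t ** X = X ** mat_exp X t"
proof (rule sums_unique2)
  show "(\<lambda>k. (t ^ k / fact k) *\<^sub>R mat_pow X (Suc k)) sums (X ** mat_exp X t)"
    using mat_exp_linear_image_sums[OF bounded_linear_matrix_mult_right] by simp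
  show "(\<lambda>k. (t ^ k / fact k) *\<^sub>R mat_pow X (Suc k)) sums (mat_exp X t ** X)"
    unfolding mat_pow_Suc_right by (rule mat_exp_linear_image_sums[OF bounded_linear_matrix_mult_left])
qed

lemma has_vector_derivative_mat_exp:
  fixes X :: "real^'n^'n"
  shows "(mat_exp X has_vector_derivative X ** mat_exp X t) (at t)"
proof (rule has_vector_derivative_vec, rule has_vector_derivative_vec)
  fix i j
  define a where "a k = mat_pow X k $ i $ j / fact k" for k
  have entry: "bounded_linear (\<lambda>A :: real^'n^'n. A $ i $ j)"
    by (intro bounded_linear_compose[OF bounded_linear_vec_nth bounded_linear_vec_nth])
  have sums: "(\<lambda>k. a k * t ^ k) sums (mat_exp X t $ i $ j)" for t
    using mat_exp_linear_image_sums[OF entry] by (simp add: a_def mult.commute)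
  have diffs: "diffs a k = mat_pow X (Suc k) $ i $ j / fact k" for k
    by (simp add: diffs_def a_def field_simps del: mat_pow.simps of_nat_Suc)
  have "(\<lambda>k. diffs a k * t ^ k) sums ((X ** mat_exp X t) $ i $ j)"
    using mat_exp_linear_image_sums[OF bounded_linear_compose[OF entry bounded_linear_matrix_mult_right]]
    by (simp add: diffs mult.commute)
  moreover have "((\<lambda>t. \<Sum>k. a k * t ^ k) has_field_derivative (\<Sum>k. diffs a k * t ^ k)) (at t)"
    by (rule termdiffs_strong_converges_everywhere) (rule sums_summable[OF sums])
  ultimately show "((\<lambda>t. mat_exp X t $ i $ j) has_vector_derivative (X ** mat_exp X t) $ i $ j) (at t)"
    using sums by (simp add: sums_iff has_real_derivative_iff_has_vector_derivative)
qed

lemma has_vector_derivative_mat_exp_minus: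
  "((\<lambda>t. mat_exp X (- t)) has_vector_derivative - (X ** mat_exp X (- t))) (at t)"
proof -
  have "((\<lambda>t. - t) has_vector_derivative (-1 :: real)) (at t)"
    by (auto intro!: derivative_eq_intros)
  then show ?thesis
    using vector_diff_chain_at[of uminus "-1" t "mat_exp X" "X ** mat_exp X (- t)"]
      has_vector_derivative_mat_exp[of X "- t"]
    by (simp add: comp_def)
qed

lemma mat_exp_inverse: "mat_exp X t ** mat_exp X (- t) = mat 1"
proof -
  have "((\<lambda>t. mat_exp X t ** mat_exp X (- t)) has_vector_derivative
      mat_exp X t ** - (X ** mat_exp X (- t)) + (X ** mat_exp X t) ** mat_exp X (- t)) (at t)" for t
    by (intro has_vector_derivative_matrix_mult has_vector_derivative_mat_exp
        has_vector_derivative_mat_exp_minus)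
  moreover have "mat_exp X t ** - (X ** mat_exp X (- t)) + (X ** mat_exp X t) ** mat_exp X (- t) = 0" for t
    by (simp add: matrix_mult_simps matrix_mul_assoc mat_exp_commute)
  ultimately obtain c where c: "\<And>t. mat_exp X t ** mat_exp X (- t) = c"
    using has_vector_derivative_zero_constant[of UNIV "\<lambda>t. mat_exp X t ** mat_exp X (- t)"] by auto
  from c[of 0] c[of t] show ?thesis by simp
qed

lemma matrix_inv_mat_exp: "matrix_inv (mat_exp X t) = mat_exp X (- t)"
  unfolding matrix_inv_def
proof (rule some_equality)
  fix B assume "mat_exp X t ** B = mat 1 \<and> B ** mat_exp X t = mat 1"
  then have "B ** mat_exp X t ** mat_exp X (- t) = mat_exp X (- t)" by simp
  then show "B = mat_exp X (- t)" by (simp add: matrix_mul_assoc[symmetric] mat_exp_inverse)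
qed (use mat_exp_inverse[of X t] mat_exp_inverse[of X "- t"] in simp)

lemma mat_exp_preserves_form:
  assumes "transpose X ** M + M ** X = 0"
  shows "transpose (mat_exp X t) ** M ** mat_exp X t = M"
proof -
  let ?f = "\<lambda>t. transpose (mat_exp X t) ** (M ** mat_exp X t)"
  have "(?f has_vector_derivative
      transpose (mat_exp X t) ** (M ** (X ** mat_exp X t) + 0 ** mat_exp X t)
        + transpose (X ** mat_exp X t) ** (M ** mat_exp X t)) (at t)" for t
    by (intro has_vector_derivative_matrix_mult has_vector_derivative_const
        bounded_linear.has_vector_derivative[OF bounded_linear_transpose] has_vector_derivative_mat_exp)
  moreover have "transpose (mat_exp X t) ** (M ** (X ** mat_exp X t) + 0 ** mat_exp X t)
        + transpose (X ** mat_exp X t) ** (M ** mat_exp X t)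
      = transpose (mat_exp X t) ** (transpose X ** M + M ** X) ** mat_exp X t" for t
    by (simp add: matrix_mult_simps matrix_transpose_mul matrix_mul_assoc)
  ultimately have "(?f has_vector_derivative 0) (at t)" for t
    using assms by (simp add: matrix_mult_simps)
  then obtain c where c: "\<And>t. ?f t = c"
    using has_vector_derivative_zero_constant[of UNIV ?f] by auto
  from c[of 0] c[of t] show ?thesis by (simp add: matrix_mul_assoc)
qed

definition conj_path :: "real^'n^'n \<Rightarrow> real^'n^'n \<Rightarrow> real \<Rightarrow> real^'n^'n" where
  "conj_path X R t = mat_exp X t ** R ** mat_exp X (- t)"

lemma conj_path_0 [simp]: "conj_path X R 0 = R"
  by (simp add: conj_path_def)

lemma has_vector_derivative_conj_path:
  "(conj_path X R has_vector_derivative conj_path X (X ** R - R ** X) t) (at t)"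
proof -
  have "(conj_path X R has_vector_derivative
      (mat_exp X t ** R) ** - (X ** mat_exp X (- t)) +
      (mat_exp X t ** 0 + (X ** mat_exp X t) ** R) ** mat_exp X (- t)) (at t)"
    unfolding conj_path_def[abs_def]
    by (intro has_vector_derivative_matrix_mult has_vector_derivative_mat_exp
        has_vector_derivative_mat_exp_minus has_vector_derivative_const)
  also have "(mat_exp X t ** R) ** - (X ** mat_exp X (- t)) +
      (mat_exp X t ** 0 + (X ** mat_exp X t) ** R) ** mat_exp X (- t)
      = conj_path X (X ** R - R ** X) t"
    unfolding conj_path_def mat_exp_commute[of X t, symmetric]
    by (simp add: matrix_mult_simps matrix_mul_assoc)
  finally show ?thesis .
qed

lemma smooth_on_conj_path: "smooth_on S (conj_path X R)"
proof -
  define D where "D k = conj_path X (((\<lambda>A. X ** A - A ** X) ^^ k) R)" for k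
  have "(D k has_vector_derivative D (Suc k) t) (at t)" for k t
    unfolding D_def by (simp add: has_vector_derivative_conj_path)
  then show ?thesis unfolding smooth_on_def by (intro exI[of _ D]) (simp add: D_def)
qed

section \<open>Lorentz geometry\<close>

lemma exhaust_5: "(i :: 5) = 0 \<or> i = 1 \<or> i = 2 \<or> i = 3 \<or> i = 4"
proof (induct i)
  case (of_int z)
  then have "z = 0 \<or> z = 1 \<or> z = 2 \<or> z = 3 \<or> z = 4" by auto
  then show ?case by auto
qed

lemma UNIV_5: "(UNIV :: 5 set) = {0, 1, 2, 3, 4}"
  using exhaust_5 by auto

lemma vec_eq_5:
  fixes v w :: "'a^5"
  shows "v = w \<longleftrightarrow> v$0 = w$0 \<and> v$1 = w$1 \<and> v$2 = w$2 \<and> v$3 = w$3 \<and> v$4 = w$4"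
proof -
  have "v = w \<longleftrightarrow> (\<forall>i\<in>UNIV. v $ i = w $ i)" by (simp add: vec_eq_iff)
  then show ?thesis by (simp only: UNIV_5 ball_simps) simp
qed

lemma sum_5: "sum f (UNIV :: 5 set) = f 0 + f 1 + f 2 + f 3 + f 4"
  for f :: "5 \<Rightarrow> 'a::comm_monoid_add"
  unfolding UNIV_5 by (simp add: ac_simps)

lemma mink_scaleR: "mink (a *\<^sub>R x) y = a * mink x y" "mink x (a *\<^sub>R y) = a * mink x y"
  and mink_add: "mink (x + z) y = mink x y + mink z y" "mink x (y + z) = mink x y + mink x z"
  and mink_diff: "mink (x - z) y = mink x y - mink z y" "mink x (y - z) = mink x y - mink x z"
  and mink_minus: "mink (- x) y = - mink x y" "mink x (- y) = - mink x y"
  and mink_commute: "mink x y = mink y x"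
  by (simp_all add: mink_def algebra_simps)

lemma mink_Mmat: "mink x y = x \<bullet> (Mmat *v y)"
  by (simp add: mink_def inner_vec_def matrix_vector_mult_def Mmat_def sum_5
      if_distrib[of "\<lambda>a. a * _"] cong: if_cong)

lemma inner_vector_matrix: "x \<bullet> (y v* A) = (A *v x) \<bullet> (y :: real^'n)"
  by (metis dot_lmul_matrix inner_commute)

lemma matrix_eq_if_inner_eq:
  fixes A B :: "real^'n^'m"
  assumes "\<And>x y. x \<bullet> (A *v y) = x \<bullet> (B *v y)"
  shows "A = B"
  unfolding matrix_eq using assms by (metis vector_eq_ldot)

lemma O14_iff: "A \<in> O14 \<longleftrightarrow> (\<forall>x y. mink (A *v x) (A *v y) = mink x y)"
proof -
  have "mink (A *v x) (A *v y) = x \<bullet> ((transpose A ** Mmat ** A) *v y)" for x y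
    by (simp add: mink_Mmat inner_vector_matrix matrix_vector_mul_assoc[symmetric])
  then show ?thesis
    unfolding O14_def using matrix_eq_if_inner_eq[of "transpose A ** Mmat ** A" Mmat]
    by (auto simp: mink_Mmat)
qed

definition so14 :: "(real^5^5) set" where
  "so14 = {X. transpose X ** Mmat + Mmat ** X = 0}"

lemma so14_iff: "X \<in> so14 \<longleftrightarrow> (\<forall>x y. mink (X *v x) y + mink x (X *v y) = 0)"
proof -
  have "mink (X *v x) y + mink x (X *v y) = x \<bullet> ((transpose X ** Mmat + Mmat ** X) *v y)" for x y
    by (simp add: mink_Mmat inner_vector_matrix matrix_vector_mul_assoc[symmetric]
        matrix_vector_mult_add_rdistrib inner_add_right)
  then show ?thesis
    unfolding so14_def using matrix_eq_if_inner_eq[of "transpose X ** Mmat + Mmat ** X" 0]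
    by auto
qed

definition spacetime :: "real \<Rightarrow> real quad \<Rightarrow> real^5" where
  "spacetime r = (\<lambda>(a, b, c, d). \<chi> i. if i = 0 then r else if i = 1 then a else if i = 2 then b
     else if i = 3 then c else d)"

definition spatial :: "real^5 \<Rightarrow> real quad" where
  "spatial v = (v$1, v$2, v$3, v$4)"

lemma spacetime_0 [simp]: "spacetime r p $ 0 = r"
  by (cases p rule: prod_cases4) (simp add: spacetime_def)

lemma spatial_spacetime [simp]: "spatial (spacetime r p) = p"
  by (cases p rule: prod_cases4) (simp add: spatial_def spacetime_def)

lemma spacetime_eqI: "x $ 0 = y $ 0 \<Longrightarrow> spatial x = spatial y \<Longrightarrow> x = y"
  by (simp add: spatial_def vec_eq_5)

lemma mink_eq_spatial: "mink x y = spatial x \<bullet> spatial y - x $ 0 * y $ 0"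
  by (simp add: mink_def spatial_def)

lemma linear_spatial: "linear spatial"
  by (intro linearI) (simp_all add: spatial_def)

lemma eq_if_spatial_eq:
  assumes "spatial x = spatial y" "mink x n = mink y n" "n $ 0 \<noteq> 0"
  shows "x = y"
  using assms by (intro spacetime_eqI) (simp_all add: mink_eq_spatial)

lemma infinitesimal_isometry_lift:
  assumes "infinitesimal_isometry f" "s \<noteq> 0"
  obtains X where "X \<in> so14" "\<And>p. spatial (X *v spacetime s p) = f p"
proof -
  obtain b W where W: "linear W" "\<And>x y. x \<bullet> W y = - (W x \<bullet> y)" and f: "f = (\<lambda>x. b + W x)"
    using assms(1) unfolding infinitesimal_isometry_def skew_def by blast
  define g where "g x = spacetime ((b \<bullet> spatial x) / s) ((x $ 0 / s) *\<^sub>R b + W (spatial x))" for x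
  have "linear g"
    by (intro linearI spacetime_eqI)
      (simp_all add: g_def linear_add[OF linear_spatial] linear_scale[OF linear_spatial]
        linear_add[OF W(1)] linear_scale[OF W(1)] inner_add_right add_divide_distrib algebra_simps)
  then have g: "matrix g *v x = g x" for x by (simp add: matrix_works)
  have "mink (g x) y + mink x (g y) = 0" for x y
    by (simp add: g_def mink_eq_spatial inner_add_left inner_add_right W(2)[of "spatial x"]
        inner_commute[of _ b] algebra_simps)
  then have "matrix g \<in> so14" by (simp add: so14_iff g)
  moreover have "spatial (matrix g *v spacetime s p) = f p" for p
    using \<open>s \<noteq> 0\<close> by (simp add: g g_def f)
  ultimately show ?thesis by (rule that)
qed

lemma mink_nonneg_if_not_future:
  assumes "x \<in> H4" "mink y y < 0" "y $ 0 \<le> 0"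
  shows "mink x y \<ge> 0"
proof -
  have x: "x $ 0 > 0" "mink x x = -1" using assms(1) by (auto simp: H4_def)
  have "norm (spatial x) ^ 2 \<le> (x $ 0)\<^sup>2" "norm (spatial y) ^ 2 \<le> (y $ 0)\<^sup>2"
    using x(2) assms(2) unfolding mink_eq_spatial power2_norm_eq_inner power2_eq_square[of "_ $ 0"]
    by linarith+
  then have "norm (spatial x) \<le> x $ 0" "norm (spatial y) \<le> - y $ 0"
    using x(1) assms(3) power2_le_imp_le[of "norm (spatial x)" "x $ 0"]
      power2_le_imp_le[of "norm (spatial y)" "- y $ 0"] by simp_all
  then have "norm (spatial x) * norm (spatial y) \<le> x $ 0 * - y $ 0"
    using x(1) by (intro mult_mono) auto
  moreover have "- (spatial x \<bullet> spatial y) \<le> norm (spatial x) * norm (spatial y)"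
    using Cauchy_Schwarz_ineq2[of "spatial x" "spatial y"] by linarith
  ultimately show ?thesis by (simp add: mink_eq_spatial)
qed

lemma time_nonzero_if_timelike:
  assumes "mink y y < 0"
  shows "y $ 0 \<noteq> 0"
proof
  assume "y $ 0 = 0"
  then have "mink y y = spatial y \<bullet> spatial y" by (simp add: mink_eq_spatial)
  then show False using assms inner_ge_zero[of "spatial y"] by linarith
qed

lemma mat_exp_in_G4:
  assumes "X \<in> so14"
  shows "mat_exp X t \<in> G4"
  unfolding G4_def
proof (intro CollectI conjI ballI)
  have O14: "mat_exp X t \<in> O14" for t
    using assms mat_exp_preserves_form by (auto simp: so14_def O14_def)
  then show "mat_exp X t \<in> O14" .
  fix x assume x: "x \<in> H4"
  define f where "f t = (mat_exp X t *v x) $ 0" for t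
  have mink: "mink (mat_exp X t *v x) (mat_exp X t *v x) = -1" for t
    using O14 x by (simp add: O14_iff H4_def)
  have "continuous_on UNIV (mat_exp X)"
    by (auto simp: continuous_on_eq_continuous_at
        intro: has_vector_derivative_continuous has_vector_derivative_mat_exp)
  then have "continuous_on UNIV f"
    unfolding f_def matrix_vector_mult_def by (auto intro!: continuous_intros)
  then have "connected (range f)" by (intro connected_continuous_image) auto
  moreover have "f 0 > 0" using x by (simp add: f_def H4_def)
  moreover have "0 \<notin> range f"
    using time_nonzero_if_timelike[of "mat_exp X _ *v x"] by (auto simp: f_def mink)
  ultimately have "f t > 0"
    using connectedD_interval[of "range f" "f t" "f 0" 0] by (meson less_imp_le not_le rangeI)
  then show "mat_exp X t *v x \<in> H4" using mink by (simp add: H4_def f_def)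
qed

section \<open>Reflections and their deformations\<close>

definition reflect :: "real^5 \<Rightarrow> real^5 \<Rightarrow> real^5" where
  "reflect n x = x - (2 * mink x n / mink n n) *\<^sub>R n"

lemma linear_reflect: "linear (reflect n)"
  by (intro linearI) (simp_all add: reflect_def mink_add mink_scaleR algebra_simps add_divide_distrib)

lemma reflect_orthogonal: "mink x n = 0 \<Longrightarrow> reflect n x = x"
  by (simp add: reflect_def)

lemma reflect_self: "mink n n \<noteq> 0 \<Longrightarrow> reflect n n = - n"
  by (simp add: reflect_def scaleR_2)

lemma mink_reflect_normal: "mink n n \<noteq> 0 \<Longrightarrow> mink (reflect n x) n = - mink x n"
  by (simp add: reflect_def mink_diff mink_scaleR)

lemma mink_reflect:
  assumes "mink n n \<noteq> 0"
  shows "mink (reflect n x) (reflect n y) = mink x y"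
proof -
  have "mink (reflect n x) (reflect n y) = mink (reflect n x) y - 2 * mink y n / mink n n * mink (reflect n x) n"
    unfolding reflect_def[of n y] by (simp add: mink_diff mink_scaleR)
  also have "\<dots> = mink x y"
    using assms by (simp add: mink_reflect_normal) (simp add: reflect_def mink_diff mink_scaleR mink_commute[of n y])
  finally show ?thesis .
qed

lemma reflect_in_H4:
  assumes "mink n n > 0" "x \<in> H4"
  shows "reflect n x \<in> H4"
proof -
  have "mink x x = -1" using assms(2) by (simp add: H4_def)
  then have norm: "mink (reflect n x) (reflect n x) = -1"
    using assms(1) by (simp add: mink_reflect)
  have "mink x (reflect n x) = -1 - 2 * (mink x n)\<^sup>2 / mink n n"
    using \<open>mink x x = -1\<close> by (simp add: reflect_def mink_diff mink_scaleR power2_eq_square)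
  moreover have "2 * (mink x n)\<^sup>2 / mink n n \<ge> 0" using assms(1) by simp
  ultimately have "mink x (reflect n x) < 0" by linarith
  then have "reflect n x $ 0 > 0"
    using mink_nonneg_if_not_future[OF assms(2), of "reflect n x"] norm by linarith
  then show ?thesis using norm by (simp add: H4_def)
qed

lemma linear_eq_if_eq_on_normal_and_orthogonal:
  assumes "linear f" "linear g" "mink n n \<noteq> 0"
    and normal: "f n = g n" and orthogonal: "\<And>y. mink y n = 0 \<Longrightarrow> f y = g y"
  shows "f x = g x"
proof -
  define c where "c = mink x n / mink n n"
  have "mink (x - c *\<^sub>R n) n = 0" using assms(3) by (simp add: c_def mink_diff mink_scaleR)
  then have "f (x - c *\<^sub>R n) = g (x - c *\<^sub>R n)" by (rule orthogonal)
  then show ?thesis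
    by (simp add: linear_diff[OF assms(1)] linear_diff[OF assms(2)] linear_scale[OF assms(1)]
        linear_scale[OF assms(2)] normal)
qed

lemma refl_mat_mult:
  assumes "mink n n > 0"
  shows "refl_mat n *v x = reflect n x"
proof -
  define A where "A = matrix (reflect n)"
  have A: "A *v x = reflect n x" for x using linear_reflect by (simp add: A_def matrix_works)
  have "refl_mat n = A"
    unfolding refl_mat_def
  proof (rule the_equality)
    have "A \<in> G4"
      using assms by (auto simp: G4_def O14_iff A mink_reflect reflect_in_H4)
    then show "A \<in> G4 \<and> (\<forall>x. mink x n = 0 \<longrightarrow> A *v x = x) \<and> A *v n = - n"
      using assms by (simp add: A reflect_orthogonal reflect_self)
  next
    fix B assume B: "B \<in> G4 \<and> (\<forall>x. mink x n = 0 \<longrightarrow> B *v x = x) \<and> B *v n = - n"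
    have "B *v x = reflect n x" for x
      by (rule linear_eq_if_eq_on_normal_and_orthogonal[of _ _ n])
        (use assms B in \<open>simp_all add: linear_reflect reflect_orthogonal reflect_self\<close>)
    then show "B = A" by (simp add: matrix_eq A)
  qed
  then show ?thesis by (simp add: A)
qed

text \<open>The derivative of \<^term>\<open>\<lambda>n. reflect n x\<close> in a direction \<open>w\<close> orthogonal to \<open>n\<close>.\<close>

definition reflect_variation :: "real^5 \<Rightarrow> real^5 \<Rightarrow> real^5 \<Rightarrow> real^5" where
  "reflect_variation n w x = (- 2 / mink n n) *\<^sub>R (mink x w *\<^sub>R n + mink x n *\<^sub>R w)"

lemma linear_reflect_variation: "linear (reflect_variation n w)"
  by (intro linearI)
    (simp_all add: reflect_variation_def mink_add mink_scaleR algebra_simps add_divide_distrib)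

lemma mink_mult_derivative:
  assumes "transpose R ** Mmat ** A + transpose A ** Mmat ** R = 0"
  shows "mink (R *v x) (A *v y) + mink (A *v x) (R *v y) = 0"
proof -
  have "mink (R *v x) (A *v y) + mink (A *v x) (R *v y) =
      x \<bullet> ((transpose R ** Mmat ** A + transpose A ** Mmat ** R) *v y)"
    by (simp add: mink_Mmat inner_vector_matrix matrix_vector_mul_assoc[symmetric]
        matrix_vector_mult_add_rdistrib inner_add_right)
  then show ?thesis using assms by simp
qed

lemma refl_mat_anticommute:
  assumes "mink n n > 0" "refl_mat n ** A + A ** refl_mat n = 0"
  shows "A *v reflect n y = - reflect n (A *v y)"
proof -
  have "reflect n (A *v y) + A *v reflect n y = (refl_mat n ** A + A ** refl_mat n) *v y"
    by (simp add: matrix_vector_mul_assoc[symmetric] matrix_vector_mult_add_rdistrib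
        refl_mat_mult[OF assms(1)])
  then show ?thesis using assms(2) by (simp add: eq_neg_iff_add_eq_0 add.commute)
qed

lemma refl_deformation:
  assumes q: "mink n n > 0"
    and form: "transpose (refl_mat n) ** Mmat ** A + transpose A ** Mmat ** refl_mat n = 0"
    and involution: "refl_mat n ** A + A ** refl_mat n = 0"
    and w: "w = (- 1 / 2) *\<^sub>R (A *v n)"
  shows "mink w n = 0" and "A *v x = reflect_variation n w x"
proof -
  note anticommute = refl_mat_anticommute[OF q involution]
  have An: "A *v n = - 2 *\<^sub>R w" by (simp add: w)
  have "reflect n (A *v n) = A *v n"
    using anticommute[of n] q linear_neg[of "(*v) A" n] by (simp add: reflect_self)
  then have "mink (A *v n) n = 0" using mink_reflect_normal[of n "A *v n"] q by simp
  then show wn: "mink w n = 0" by (simp add: w mink_scaleR mink_minus)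
  show "A *v x = reflect_variation n w x"
  proof (rule linear_eq_if_eq_on_normal_and_orthogonal[OF _ linear_reflect_variation])
    show "A *v n = reflect_variation n w n"
      using q wn by (simp add: An reflect_variation_def mink_commute[of n w])
    fix y assume y: "mink y n = 0"
    have "A *v y = - reflect n (A *v y)" using anticommute[of y] by (simp add: reflect_orthogonal[OF y])
    then have "2 *\<^sub>R (A *v y) = 2 *\<^sub>R (mink (A *v y) n / mink n n) *\<^sub>R n"
      unfolding reflect_def by (simp add: scaleR_2 algebra_simps)
    then have "A *v y = (mink (A *v y) n / mink n n) *\<^sub>R n"
      by (simp only: scaleR_cancel_left) simp
    moreover have "mink (A *v y) n = - 2 * mink y w"
      using mink_mult_derivative[OF form, of y n] q
      by (simp add: refl_mat_mult reflect_orthogonal[OF y] reflect_self An mink_minus mink_scaleR)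
    ultimately show "A *v y = reflect_variation n w y" by (simp add: reflect_variation_def y)
  qed (use q in simp_all)
qed

lemma commuting_refl_deformations:
  assumes q: "mink n n > 0" "mink m m > 0" and orthogonal: "mink n m = 0"
    and A: "\<And>x. A *v x = reflect_variation n w x" and B: "\<And>x. B *v x = reflect_variation m w' x"
    and w: "mink w n = 0"
    and relation: "(refl_mat n ** refl_mat m) ** (refl_mat n ** B + A ** refl_mat m)
      + (refl_mat n ** B + A ** refl_mat m) ** (refl_mat n ** refl_mat m) = 0"
  shows "mink w m + mink n w' = 0"
proof -
  define z where "z = reflect n (B *v n) + A *v n"
  have fixed: "reflect m n = n" "reflect n m = m" "reflect n n = - n"
    using orthogonal q by (simp_all add: reflect_orthogonal reflect_self mink_commute)
  have z: "z = (- 2 / mink m m * mink n w') *\<^sub>R m - 2 *\<^sub>R w"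
    using q orthogonal w
    by (simp add: z_def A B reflect_variation_def linear_scale[OF linear_reflect]
        linear_neg[OF linear_reflect] fixed mink_commute)
  have "reflect n (reflect m z) - z =
      ((refl_mat n ** refl_mat m) ** (refl_mat n ** B + A ** refl_mat m)
        + (refl_mat n ** B + A ** refl_mat m) ** (refl_mat n ** refl_mat m)) *v n"
    by (simp add: z_def matrix_vector_mult_add_rdistrib matrix_vector_mul_assoc[symmetric]
        refl_mat_mult q fixed linear_neg[OF linear_reflect] linear_neg[of "(*v) A"] linear_neg[of "(*v) B"])
  then have "mink (reflect n (reflect m z)) m = mink z m" using relation by simp
  moreover have "mink (reflect n (reflect m z)) m = - mink z m"
  proof -
    have "mink (reflect n (reflect m z)) m = mink (reflect n (reflect m z)) (reflect n m)" by (simp add: fixed)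
    also have "\<dots> = - mink z m" using q by (simp add: mink_reflect mink_reflect_normal)
    finally show ?thesis .
  qed
  ultimately have "mink z m = 0" by simp
  then show ?thesis using q by (simp add: z mink_diff mink_scaleR mink_minus)
qed

lemma reflect_variation_so14_is_commutator:
  assumes q: "mink n n > 0" and X: "X \<in> so14" and A: "\<And>x. A *v x = reflect_variation n (X *v n) x"
  shows "A = X ** refl_mat n - refl_mat n ** X"
proof -
  have skew: "mink (X *v x) y = - mink x (X *v y)" for x y
    using X by (simp add: so14_iff eq_neg_iff_add_eq_0)
  have "A *v x = (X ** refl_mat n - refl_mat n ** X) *v x" for x
    by (simp add: A reflect_variation_def refl_mat_mult[OF q] reflect_def matrix_vector_mult_diff_rdistrib
        matrix_vector_mul_assoc[symmetric] matrix_vector_mult_diff_distrib matrix_vector_mult_scaleR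
        skew algebra_simps)
  then show ?thesis by (simp add: matrix_eq)
qed

lemma inf_deformation_equations:
  assumes "inf_deformation \<rho> v" and n: "n \<in> normals96"
  shows "transpose (\<rho> n) ** Mmat ** v n + transpose (v n) ** Mmat ** \<rho> n = 0"
    and "\<rho> n ** v n + v n ** \<rho> n = 0"
    and "m \<in> normals96 \<Longrightarrow> n \<noteq> m \<Longrightarrow> walls_intersect n m \<Longrightarrow>
      (\<rho> n ** \<rho> m) ** (\<rho> n ** v m + v n ** \<rho> m) + (\<rho> n ** v m + v n ** \<rho> m) ** (\<rho> n ** \<rho> m) = 0"
proof -
  obtain p where p0: "\<And>n. n \<in> normals96 \<Longrightarrow> p 0 n = \<rho> n"
    and p': "\<And>n. n \<in> normals96 \<Longrightarrow> ((\<lambda>t. p t n) has_vector_derivative v n) (at 0)"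
    and form: "\<And>n. n \<in> normals96 \<Longrightarrow>
      ((\<lambda>t. transpose (p t n) ** Mmat ** p t n - Mmat) has_vector_derivative 0) (at 0)"
    and involution: "\<And>n. n \<in> normals96 \<Longrightarrow> ((\<lambda>t. p t n ** p t n - mat 1) has_vector_derivative 0) (at 0)"
    and relation: "\<And>n m. n \<in> normals96 \<Longrightarrow> m \<in> normals96 \<Longrightarrow> n \<noteq> m \<Longrightarrow> walls_intersect n m \<Longrightarrow>
      ((\<lambda>t. (p t n ** p t m) ** (p t n ** p t m) - mat 1) has_vector_derivative 0) (at 0)"
    using assms unfolding inf_deformation_def by blast
  show "transpose (\<rho> n) ** Mmat ** v n + transpose (v n) ** Mmat ** \<rho> n = 0"
    using preserved_form_derivative[OF p'[OF n] form[OF n]] by (simp add: p0[OF n])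
  show "\<rho> n ** v n + v n ** \<rho> n = 0"
    using constant_square_derivative[OF p'[OF n] involution[OF n]] by (simp add: p0[OF n])
  assume m: "m \<in> normals96" "n \<noteq> m" "walls_intersect n m"
  have "((\<lambda>t. p t n ** p t m) has_vector_derivative p 0 n ** v m + v n ** p 0 m) (at 0)"
    by (intro has_vector_derivative_matrix_mult p' n m(1))
  from constant_square_derivative[OF this relation[OF n m]]
  show "(\<rho> n ** \<rho> m) ** (\<rho> n ** v m + v n ** \<rho> m)
      + (\<rho> n ** v m + v n ** \<rho> m) ** (\<rho> n ** \<rho> m) = 0"
    by (simp add: p0[OF n] p0[OF m(1)])
qed

section \<open>The walls of the 120-cell\<close>

definition wall_normal :: "golden quad \<Rightarrow> real^5" where
  "wall_normal x = spacetime (sqrt (2 * tau)) (real_quad x)"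

lemma wall_normal_0: "wall_normal x $ 0 = sqrt (2 * tau)"
  and spatial_wall_normal: "spatial (wall_normal x) = real_quad x"
  by (simp_all add: wall_normal_def)

lemma mink_wall_normal: "mink (wall_normal x) (wall_normal y) = real_quad x \<bullet> real_quad y - 2 * tau"
  using tau_bounds by (simp add: mink_eq_spatial wall_normal_0 spatial_wall_normal)

lemma vec5_eq_spacetime: "vec5 f = spacetime (f 0) (f 1, f 2, f 3, f 4)"
  by (simp add: vec5_def spacetime_def del: One_nat_def)

lemma permutes_insert_iff:
  "\<sigma> permutes insert a S \<longleftrightarrow> (\<exists>b\<in>insert a S. \<exists>p. p permutes S \<and> \<sigma> = Transposition.transpose a b \<circ> p)"
proof -
  have "\<sigma> permutes insert a S \<longleftrightarrow> \<sigma> \<in> {p. p permutes insert a S}" by simp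
  also have "\<dots> \<longleftrightarrow> (\<exists>b\<in>insert a S. \<exists>p. p permutes S \<and> \<sigma> = Transposition.transpose a b \<circ> p)"
    unfolding permutes_insert by (auto simp: image_iff)
  finally show ?thesis .
qed

definition transpositions_1234 :: "nat \<times> nat \<times> nat \<Rightarrow> nat \<Rightarrow> nat" where
  "transpositions_1234 = (\<lambda>(b, c, d). Transposition.transpose 1 b \<circ>
     (Transposition.transpose 2 c \<circ> Transposition.transpose 3 d))"

lemma permutes_1234:
  "{\<sigma>. \<sigma> permutes {1..4}} = transpositions_1234 ` ({1, 2, 3, 4} \<times> {2, 3, 4} \<times> {3, 4})"
proof -
  have four: "{1..4::nat} = insert 1 (insert 2 (insert 3 {4}))" by auto
  have "\<sigma> permutes {1..4::nat} \<longleftrightarrow> (\<exists>b\<in>{1, 2, 3, 4}. \<exists>c\<in>{2, 3, 4}. \<exists>d\<in>{3, 4}.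
      \<sigma> = transpositions_1234 (b, c, d))" for \<sigma>
    unfolding four transpositions_1234_def prod.case permutes_insert_iff[of _ 1 "{2, 3, 4}"]
      permutes_insert_iff[of _ 2 "{3, 4}"] permutes_insert_iff[of _ 3 "{4}"] permutes_sing
    by (simp only: simp_thms comp_id) blast
  then show ?thesis
    by (simp only: set_eq_iff mem_Collect_eq image_iff split_paired_Bex_Sigma prod.case simp_thms)
qed

lemma evenperm_transpositions_1234:
  "evenperm (transpositions_1234 (b, c, d)) \<longleftrightarrow> ((1 = b) = ((2 = c) = (3 = d)))"
  by (simp add: transpositions_1234_def evenperm_comp permutation_compose permutation_swap_id evenperm_swap)

lemma even_permutations_1234:
  "{\<sigma>. \<sigma> permutes {1..4} \<and> evenperm \<sigma>} = transpositions_1234 `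
    {(1, 2, 3), (2, 3, 3), (3, 3, 3), (2, 2, 4), (1, 4, 4), (4, 2, 4), (3, 2, 4), (2, 4, 3),
     (4, 3, 3), (1, 3, 4), (3, 4, 3), (4, 4, 3)}" (is "_ = _ ` ?E")
proof -
  define S :: "(nat \<times> nat \<times> nat) set" where "S = {1, 2, 3, 4} \<times> {2, 3, 4} \<times> {3, 4}"
  have "{s \<in> S. evenperm (transpositions_1234 s)} = ?E"
  proof
    show "{s \<in> S. evenperm (transpositions_1234 s)} \<subseteq> ?E"
    proof
      fix s assume s: "s \<in> {s \<in> S. evenperm (transpositions_1234 s)}"
      obtain b c d where bcd: "s = (b, c, d)" by (rule prod_cases3)
      then have "b \<in> {1, 2, 3, 4}" "c \<in> {2, 3, 4}" "d \<in> {3, 4}" "(1 = b) = ((2 = c) = (3 = d))"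
        using s evenperm_transpositions_1234 by (simp_all only: S_def mem_Collect_eq mem_Sigma_iff)
      then show "s \<in> ?E"
        unfolding bcd by (elim insertE emptyE; simp)
    qed
    show "?E \<subseteq> {s \<in> S. evenperm (transpositions_1234 s)}"
      by (simp add: S_def evenperm_transpositions_1234)
  qed
  moreover have "{\<sigma>. \<sigma> permutes {1..4} \<and> evenperm \<sigma>} = {\<sigma> \<in> transpositions_1234 ` S. evenperm \<sigma>}"
    unfolding S_def permutes_1234[symmetric] by simp
  moreover have "\<dots> = transpositions_1234 ` {s \<in> S. evenperm (transpositions_1234 s)}" by blast
  ultimately show ?thesis by simp
qed

lemma even_permutations_quad:
  "{(g (\<sigma> 1), g (\<sigma> 2), g (\<sigma> 3), g (\<sigma> 4)) | \<sigma>. \<sigma> permutes {1..4::nat} \<and> evenperm \<sigma>} =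
    (\<lambda>p. p (g 1, g 2, g 3, g 4)) ` set even_permutations"
proof -
  have "{(g (\<sigma> 1), g (\<sigma> 2), g (\<sigma> 3), g (\<sigma> 4)) | \<sigma>. \<sigma> permutes {1..4::nat} \<and> evenperm \<sigma>} =
     (\<lambda>\<sigma>. (g (\<sigma> 1), g (\<sigma> 2), g (\<sigma> 3), g (\<sigma> 4))) ` {\<sigma>. \<sigma> permutes {1..4} \<and> evenperm \<sigma>}"
    by auto
  then show ?thesis
    unfolding even_permutations_1234
    by (simp add: transpositions_1234_def Transposition.transpose_def even_permutations_def cycles_def)
qed

lemma real_quad_even_permutations:
  "real_quad ` (\<lambda>p. p x) ` set even_permutations = (\<lambda>p. p (real_quad x)) ` set even_permutations"
  by (cases x rule: prod_cases4) (simp add: even_permutations_def cycles_def)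

lemma real_quad_sign_changes_base:
  "(\<lambda>s. real_quad (s base)) ` set sign_changes =
    (\<Union>s1\<in>{-1, 1}. \<Union>s2\<in>{-1, 1}. \<Union>s3\<in>{-1, 1}. {(s1 * tau, s2, s3 / tau, 0)})"
  unfolding divide_tau by (simp add: sign_changes_def base_def)

lemma normals96_eq: "normals96 = wall_normal ` set V96"
proof -
  define g where "g s1 s2 s3 j = (if j = 1 then s1 * tau else if j = 2 then s2
     else if j = 3 then s3 / tau else 0)" for s1 s2 s3 :: real and j :: nat
  have permuted: "{(g s1 s2 s3 (\<sigma> 1), g s1 s2 s3 (\<sigma> 2), g s1 s2 s3 (\<sigma> 3), g s1 s2 s3 (\<sigma> 4)) | \<sigma>.
      \<sigma> permutes {1..4} \<and> evenperm \<sigma>} = (\<lambda>p. p (s1 * tau, s2, s3 / tau, 0)) ` set even_permutations"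
    for s1 s2 s3
    unfolding even_permutations_quad by (simp add: g_def)
  define signs where "signs = {-1, 1 :: real}"
  have "normals96 = (\<Union>s1\<in>signs. \<Union>s2\<in>signs. \<Union>s3\<in>signs. spacetime (sqrt (2 * tau)) `
      {(g s1 s2 s3 (\<sigma> 1), g s1 s2 s3 (\<sigma> 2), g s1 s2 s3 (\<sigma> 3), g s1 s2 s3 (\<sigma> 4)) | \<sigma>.
        \<sigma> permutes {1..4} \<and> evenperm \<sigma>})"
    unfolding normals96_def vec5_eq_spacetime g_def[symmetric] signs_def[symmetric] by auto blast
  also have "\<dots> = (\<Union>q\<in>(\<lambda>s. real_quad (s base)) ` set sign_changes.
      spacetime (sqrt (2 * tau)) ` (\<lambda>p. p q) ` set even_permutations)"
    unfolding permuted real_quad_sign_changes_base signs_def[symmetric] by blast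
  also have "\<dots> = (\<Union>s\<in>set sign_changes. spacetime (sqrt (2 * tau)) ` real_quad `
      (\<lambda>p. p (s base)) ` set even_permutations)"
    unfolding real_quad_even_permutations by simp
  also have "\<dots> = wall_normal ` set V96"
    by (simp add: V96_def wall_normal_def image_UN image_image)
  finally show ?thesis .
qed

lemma normalsC_subset: "normalsC \<subseteq> wall_normal ` set C24"
proof -
  have four: "{1..4::nat} = {1, 2, 3, 4}" by auto
  have "\<exists>p\<in>set C24. vec5 (\<lambda>k. if k = 0 then sqrt (2 * tau) else if k = m then s * 2 else 0) = wall_normal p"
    if "m \<in> {1..4}" "s \<in> {-1, 1}" for m :: nat and s :: real
    using that unfolding four vec5_eq_spacetime wall_normal_def C24_def
    by (auto simp: zero_prod_def)
  moreover have "\<exists>p\<in>set C24. vec5 (\<lambda>k. if k = 0 then sqrt (2 * tau) else s k) = wall_normal p"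
    if "\<forall>k\<in>{1..4}. s k \<in> {-1, 1}" for s :: "nat \<Rightarrow> real"
  proof -
    have "s 1 \<in> {-1, 1}" "s 2 \<in> {-1, 1}" "s 3 \<in> {-1, 1}" "s 4 \<in> {-1, 1}"
      using that by auto
    then show ?thesis unfolding vec5_eq_spacetime wall_normal_def C24_def by auto
  qed
  ultimately show ?thesis unfolding normalsC_def by blast
qed

lemma dot_self: "x \<in> set V96 \<Longrightarrow> dot x x = Golden 4 0"
  by (erule V96_transitive) (simp add: symmetry_dot base_def)

lemma inner_self: "x \<in> set V96 \<Longrightarrow> real_quad x \<bullet> real_quad x = 4"
  by (simp add: real_of_golden_dot[symmetric] dot_self)

lemma dot_base:
  "\<forall>k\<in>set (V96 @ C24). k = base \<or> dot k base \<in>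
    {Golden 0 2, Golden 2 0, Golden (-2) 2, Golden 0 0, Golden 2 (-2), Golden (-2) 0, Golden 0 (-2), Golden (-4) 0}"
  by code_simp

lemma inner_V96_le:
  assumes "x \<in> set V96" "k \<in> set (V96 @ C24)" "k \<noteq> x"
  shows "real_quad k \<bullet> real_quad x \<le> 2 * tau"
proof -
  have invariant: "g ` set (V96 @ C24) = set (V96 @ C24)" if "symmetry g" for g
    using that by (simp add: image_Un symmetry_image_V96 symmetry_image_C24)
  obtain g z where g: "symmetry g" "x = g base" "k = g z" and z: "z \<in> set (V96 @ C24)"
    using V96_pair_transitive[OF assms(1,2) invariant] by blast
  have "z \<noteq> base" using g(2,3) assms(3) by blast
  then have "real_of_golden (dot z base) \<le> 2 * tau" using bspec[OF dot_base z] tau_bounds by auto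
  then show ?thesis
    using g by (simp add: real_of_golden_dot[symmetric] symmetry_dot[OF g(1)])
qed

lemma walls_intersect_if_timelike:
  assumes "mink z z < 0" "z $ 0 > 0" and "\<And>k. k \<in> normals120 \<Longrightarrow> mink z k \<le> 0"
    and "mink z n = 0" "mink z m = 0"
  shows "walls_intersect n m"
proof -
  define c where "c = 1 / sqrt (- mink z z)"
  have c: "c > 0" "c * c * mink z z = -1"
    using assms(1) by (simp_all add: c_def field_simps)
  have "c *\<^sub>R z \<in> P120"
    using assms(2,3) c by (auto simp: P120_def H4_def mink_scaleR mult_le_0_iff)
  then show ?thesis
    using assms(4,5) by (auto simp: walls_intersect_def wall_def mink_scaleR)
qed

lemma walls_intersect_if_adjacent:
  assumes x: "x \<in> set V96" and y: "y \<in> set V96" and adjacent: "adjacent x y"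
  shows "walls_intersect (wall_normal x) (wall_normal y)"
proof (rule walls_intersect_if_timelike)
  define a where "a = 4 + 2 * tau"
  define z where "z = spacetime (a / sqrt (2 * tau)) (real_quad x + real_quad y)"
  have inner: "real_quad x \<bullet> real_quad x = 4" "real_quad y \<bullet> real_quad y = 4"
    "real_quad x \<bullet> real_quad y = 2 * tau" "real_quad y \<bullet> real_quad x = 2 * tau"
    using inner_self[OF x] inner_self[OF y] adjacent real_of_golden_dot[of x y]
    by (simp_all add: adjacent_def inner_commute)
  have mink_z: "mink z (wall_normal k) = real_quad x \<bullet> real_quad k + real_quad y \<bullet> real_quad k - a" for k
    using tau_bounds by (simp add: z_def wall_normal_def mink_eq_spatial inner_add_left)
  then show "mink z (wall_normal x) = 0" "mink z (wall_normal y) = 0" by (simp_all add: inner a_def)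
  show "z $ 0 > 0" using tau_bounds by (simp add: z_def a_def)
  have "mink z z = 2 * a - a\<^sup>2 / (2 * tau)"
    using tau_bounds
    by (simp add: z_def mink_eq_spatial inner_add_left inner_add_right inner a_def power2_eq_square)
  also have "\<dots> = a * (tau - 2) / tau"
    using tau_bounds by (simp add: a_def field_simps power2_eq_square)
  also have "\<dots> < 0"
    using tau_bounds by (simp add: a_def divide_neg_pos mult_pos_neg)
  finally show "mink z z < 0" .
  fix n assume "n \<in> normals120"
  then obtain k where k: "k \<in> set (V96 @ C24)" "n = wall_normal k"
    using normalsC_subset unfolding normals120_def normals96_eq set_append by blast
  have "real_quad x \<bullet> real_quad k + real_quad y \<bullet> real_quad k \<le> a"
  proof (cases "k = x \<or> k = y")
    case True
    then show ?thesis using inner by (auto simp: a_def)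
  next
    case False
    then show ?thesis
      using inner_V96_le[OF x k(1)] inner_V96_le[OF y k(1)] tau_bounds
      by (simp add: inner_commute a_def)
  qed
  then show "mink z n \<le> 0" by (simp add: k(2) mink_z)
qed

section \<open>Infinitesimal rigidity\<close>

lemma inf_conjugation_if_commutator:
  assumes X: "X \<in> so14"
    and v: "\<And>n. n \<in> normals96 \<Longrightarrow> v n = X ** \<rho> n - \<rho> n ** X"
  shows "inf_conjugation \<rho> v"
  unfolding inf_conjugation_def
proof (intro exI[of _ "1 :: real"] exI[of _ "\<lambda>t n. conj_path X (\<rho> n) t"] conjI ballI)
  show "smooth_path 1 (\<lambda>t n. conj_path X (\<rho> n) t)"
    by (simp add: smooth_path_def smooth_on_conj_path)
next
  fix n assume "n \<in> normals96"
  then show "((\<lambda>t. conj_path X (\<rho> n) t) has_vector_derivative v n) (at 0)"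
    using has_vector_derivative_conj_path[of X "\<rho> n" 0] by (simp add: v)
next
  fix t
  show "\<exists>g\<in>G4. \<forall>n\<in>normals96. conj_path X (\<rho> n) t = g ** \<rho> n ** matrix_inv g"
    by (intro bexI[of _ "mat_exp X t"] ballI)
      (simp_all add: conj_path_def matrix_inv_mat_exp mat_exp_in_G4[OF X])
qed simp_all

lemma wall_normal_in_normals96: "x \<in> set V96 \<Longrightarrow> wall_normal x \<in> normals96"
  by (simp add: normals96_eq)

lemma mink_pos_if_normals96: "n \<in> normals96 \<Longrightarrow> mink n n > 0"
  using tau_bounds unfolding normals96_eq
  by (elim imageE) (simp add: mink_wall_normal inner_self)

definition wall_variation :: "(real^5 \<Rightarrow> real^5) \<Rightarrow> bool" where
  "wall_variation w \<longleftrightarrow> (\<forall>n\<in>normals96. mink (w n) n = 0) \<and>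
    (\<forall>n\<in>normals96. \<forall>m\<in>normals96. mink n m = 0 \<and> walls_intersect n m \<longrightarrow>
      mink (w n) m + mink n (w m) = 0)"

lemma inf_deformation_refl_mat:
  assumes "inf_deformation refl_mat v"
  obtains w where "wall_variation w"
    "\<And>n x. n \<in> normals96 \<Longrightarrow> v n *v x = reflect_variation n (w n) x"
proof -
  define w where "w n = (- 1 / 2) *\<^sub>R (v n *v n)" for n
  note equations = inf_deformation_equations[OF assms]
  have w: "mink (w n) n = 0" and v: "v n *v x = reflect_variation n (w n) x"
    if "n \<in> normals96" for n x
    using refl_deformation[OF mink_pos_if_normals96 equations(1,2) w_def] that by blast+
  have pair: "mink (w n) m + mink n (w m) = 0"
    if n: "n \<in> normals96" and m: "m \<in> normals96" and "mink n m = 0" "walls_intersect n m" for n m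
  proof (rule commuting_refl_deformations)
    have "n \<noteq> m" using mink_pos_if_normals96[OF n] \<open>mink n m = 0\<close> by auto
    then show "(refl_mat n ** refl_mat m) ** (refl_mat n ** v m + v n ** refl_mat m)
        + (refl_mat n ** v m + v n ** refl_mat m) ** (refl_mat n ** refl_mat m) = 0"
      using equations(3) n m \<open>walls_intersect n m\<close> by blast
  qed (fact mink_pos_if_normals96[OF n] mink_pos_if_normals96[OF m] \<open>mink n m = 0\<close> v[OF n] v[OF m] w[OF n])+
  have "wall_variation w" unfolding wall_variation_def using w pair by blast
  then show ?thesis using that v by blast
qed

lemma motion_if_wall_variation:
  assumes "wall_variation w"
  shows "motion (\<lambda>x. spatial (w (wall_normal x)))"
  unfolding motion_def
proof (intro ballI impI)
  fix x y assume x: "x \<in> set V96" and y: "y \<in> set V96" and adjacent: "adjacent x y"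
  note normals = wall_normal_in_normals96[OF x] wall_normal_in_normals96[OF y]
  have "mink (wall_normal x) (wall_normal y) = 0"
    using adjacent by (simp add: mink_wall_normal real_of_golden_dot[symmetric] adjacent_def)
  then have "mink (w (wall_normal x)) (wall_normal y) + mink (w (wall_normal y)) (wall_normal x) = 0"
    using assms walls_intersect_if_adjacent[OF x y adjacent] normals
    by (simp add: wall_variation_def mink_commute)
  moreover have "mink (w (wall_normal x)) (wall_normal x) = 0" "mink (w (wall_normal y)) (wall_normal y) = 0"
    using assms normals by (simp_all add: wall_variation_def)
  ultimately show "preserves_length real_quad (\<lambda>x. spatial (w (wall_normal x))) x y"
    by (simp add: preserves_length_def mink_eq_spatial wall_normal_0 spatial_wall_normal
        inner_diff_left inner_diff_right)
qed

lemma wall_variation_in_so14: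
  assumes "wall_variation w"
  obtains X where "X \<in> so14" "\<And>n. n \<in> normals96 \<Longrightarrow> w n = X *v n"
proof -
  obtain f where f: "infinitesimal_isometry f"
    "\<And>x. x \<in> set V96 \<Longrightarrow> spatial (w (wall_normal x)) = f (real_quad x)"
    using motion_is_infinitesimal_isometry[OF motion_if_wall_variation[OF assms]] by blast
  have time: "sqrt (2 * tau) \<noteq> 0" using tau_bounds by simp
  obtain X where X: "X \<in> so14" "\<And>p. spatial (X *v spacetime (sqrt (2 * tau)) p) = f p"
    using infinitesimal_isometry_lift[OF f(1) time] by blast
  have "w n = X *v n" if n: "n \<in> normals96" for n
  proof (rule eq_if_spatial_eq)
    obtain x where x: "x \<in> set V96" "n = wall_normal x" using n unfolding normals96_eq by (elim imageE)
    show "spatial (w n) = spatial (X *v n)"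
      using f(2)[OF x(1)] by (simp add: x(2) X(2) wall_normal_def)
    show "n $ 0 \<noteq> 0" using time by (simp add: x(2) wall_normal_0)
    have "mink (X *v n) n + mink n (X *v n) = 0" using X(1) by (simp add: so14_iff)
    then have "mink (X *v n) n = 0" by (simp add: mink_commute[of n])
    then show "mink (w n) n = mink (X *v n) n" using assms n by (simp add: wall_variation_def)
  qed
  then show ?thesis using X(1) that by blast
qed

theorem theorem4p1:
  shows "inf_rigid refl_mat"
  unfolding inf_rigid_def
proof (intro allI impI)
  fix v assume "inf_deformation refl_mat v"
  then obtain w where "wall_variation w"
    and v: "\<And>n x. n \<in> normals96 \<Longrightarrow> v n *v x = reflect_variation n (w n) x"
    by (rule inf_deformation_refl_mat) blast
  then obtain X where X: "X \<in> so14" "\<And>n. n \<in> normals96 \<Longrightarrow> w n = X *v n"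
    using wall_variation_in_so14 by blast
  have "v n = X ** refl_mat n - refl_mat n ** X" if "n \<in> normals96" for n
    using reflect_variation_so14_is_commutator[OF mink_pos_if_normals96[OF that] X(1)]
      v[OF that] X(2)[OF that] by simp
  then show "inf_conjugation refl_mat v" by (rule inf_conjugation_if_commutator[OF X(1)])
qed

end
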